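(* Let $p,q,r>1$, $A>0$, $B>0$, $R\ge 1$, and let $(f,g)\in C_0^2(\mathbf{R})\times C_0^1(\mathbf{R})$ satisfy $\mathrm{supp}\,f,\ \mathrm{supp}\,g\subset\{x\in\mathbf{R}: |x|\le R\}$ and $$\int_{\mathbf{R}}g(x)\,dx=0.$$ Then there exist a positive constant $\varepsilon_2=\varepsilon_2(f,g,p,q,r,A,B,R)>0$ and a positive constant $c$ independent of $\varepsilon$ such that, for every $\varepsilon$ with $0<\varepsilon\le\varepsilon_2$, a classical solution $u\in C^2(\mathbf{R}\times[0,T])$ of the initial value problem $$u_{tt}-u_{xx}=A|u_t|^p|u|^q+B|u|^r,\qquad u(x,0)=\varepsilon f(x),\quad u_t(x,0)=\varepsilon g(x)\quad (x\in\mathbf{R})$$ exists as far as $T>0$ satisfies $$T\le\begin{cases} c\,\varepsilon^{-(p+q-1)} & \text{if } p+q\le\dfrac{r+1}{2},\\[2mm] c\,\varepsilon^{-(p+q)(r-1)/(r+1)} & \text{if } \dfrac{r+1}{2}\le p+q\le r,\\[2mm] c\,\varepsilon^{-r(r-1)/(r+1)} & \text{if } p+q\ge r.\end{cases}$$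
   Context: $C_0^k(\mathbf{R})$ denotes the real-valued $C^k$ functions on $\mathbf{R}$ with compact support. A classical solution in the time interval $[0,T]$ is a real-valued function $u\in C^2(\mathbf{R}\times[0,T])$ satisfying the equation and the initial conditions pointwise. The space dimension is one. *)

theory Defs
  imports "HOL-Analysis.Analysis"
begin

definition Ck_real :: "nat \<Rightarrow> (real \<Rightarrow> real) \<Rightarrow> bool" where
  "Ck_real k f \<longleftrightarrow>
     (\<forall>j<k. \<forall>x. (deriv ^^ j) f differentiable (at x)) \<and>
     (\<forall>j\<le>k. continuous_on UNIV ((deriv ^^ j) f))"

definition topological_support :: "(real \<Rightarrow> real) \<Rightarrow> real set" where
  "topological_support f = closure {x. f x \<noteq> 0}"

definition Ck_real_compact :: "nat \<Rightarrow> (real \<Rightarrow> real) \<Rightarrow> bool" where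
  "Ck_real_compact k f \<longleftrightarrow> Ck_real k f \<and> compact (topological_support f)"

text \<open>
  A function on the strip \<open>\<real> \<times> [0,T]\<close> is a curried function of \<open>x\<close> and \<open>t\<close>. Only its values
  for \<open>0 \<le> t \<le> T\<close> matter: the time derivative is taken within \<open>[0,T]\<close>, so it is the one-sided
  derivative at \<open>t = 0\<close> and \<open>t = T\<close>. The definitions are meaningful for \<open>T > 0\<close> only.
\<close>

definition dx :: "(real \<Rightarrow> real \<Rightarrow> real) \<Rightarrow> real \<Rightarrow> real \<Rightarrow> real" where
  "dx u x t = deriv (\<lambda>y. u y t) x"

definition dt :: "real \<Rightarrow> (real \<Rightarrow> real \<Rightarrow> real) \<Rightarrow> real \<Rightarrow> real \<Rightarrow> real" where
  "dt T u x t = vector_derivative (\<lambda>s. u x s) (at t within {0..T})"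

text \<open>
  \<open>C\<^sup>k(\<real> \<times> [0,T])\<close>: all partial derivatives up to order \<open>k\<close>, in every order of
  differentiation, exist and are jointly continuous on the closed strip.
\<close>

primrec Ck_strip :: "real \<Rightarrow> nat \<Rightarrow> (real \<Rightarrow> real \<Rightarrow> real) \<Rightarrow> bool" where
  "Ck_strip T 0 u \<longleftrightarrow> continuous_on (UNIV \<times> {0..T}) (\<lambda>(x, t). u x t)"
| "Ck_strip T (Suc k) u \<longleftrightarrow>
     continuous_on (UNIV \<times> {0..T}) (\<lambda>(x, t). u x t) \<and>
     (\<forall>x. \<forall>t\<in>{0..T}. (\<lambda>y. u y t) differentiable (at x) \<and>
                      (\<lambda>s. u x s) differentiable (at t within {0..T})) \<and>
     Ck_strip T k (dx u) \<and> Ck_strip T k (dt T u)"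

text \<open>
  Classical solutions in \<open>[0,T]\<close> of \<open>u_tt - u_xx = A |u_t|^p |u|^q + B |u|^r\<close> with
  initial data \<open>u(x,0) = \<phi>(x)\<close>, \<open>u_t(x,0) = \<psi>(x)\<close>.
\<close>

definition classical_solution ::
  "real \<Rightarrow> real \<Rightarrow> real \<Rightarrow> real \<Rightarrow> real \<Rightarrow> (real \<Rightarrow> real) \<Rightarrow> (real \<Rightarrow> real) \<Rightarrow> real
    \<Rightarrow> (real \<Rightarrow> real \<Rightarrow> real) \<Rightarrow> bool" where
  "classical_solution A B p q r \<phi> \<psi> T u \<longleftrightarrow>
     Ck_strip T 2 u \<and>
     (\<forall>x. \<forall>t\<in>{0..T}.
        dt T (dt T u) x t - dx (dx u) x t
          = A * \<bar>dt T u x t\<bar> powr p * \<bar>u x t\<bar> powr q + B * \<bar>u x t\<bar> powr r) \<and>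
     (\<forall>x. u x 0 = \<phi> x \<and> dt T u x 0 = \<psi> x)"

end

theory Submission
  imports Defs
begin

text \<open>
  Write the initial value problem as a fixed point problem for the source \<open>G = F(u, u\<^sub>t)\<close>, where \<open>u\<close> is
  the free solution with the given data plus Duhamel's integral of \<open>G\<close>.

  The mean of \<open>g\<close> is zero, so \<open>g\<close> has a compactly supported primitive (\<open>compactly_supported_primitive\<close>)
  and the free solution is a sum of two compactly supported travelling waves. It is of size \<open>\<epsilon>\<close> in a
  bounded neighbourhood of the light cone and zero inside the cone. The source \<open>G\<close> is therefore
  estimated by two constants (\<open>cone_bounded\<close>): \<open>a\<close> near the cone and \<open>b\<close> inside it. Near the cone \<open>u\<close> and
  \<open>u\<^sub>t\<close> are of size \<open>\<epsilon>\<close>, so \<open>a\<close> is of order \<open>\<epsilon> powr (p + q) + \<epsilon> powr r\<close>, that is, of order \<open>\<epsilon> powr m\<close> with \<open>m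
  = min (p + q) r\<close>. A characteristic or a vertical line crosses the neighbourhood of the cone in
  bounded time, unless the characteristic runs along the cone. It follows (\<open>duhamel_t_cone_bounded\<close>,
  \<open>duhamel_cone_bounded\<close>) that the perturbation of \<open>u\<close> is at most \<open>3 R a T + b T\<^sup>2\<close>, and that its time
  derivative is at most \<open>R a + T b\<close> inside the cone, smaller by a factor \<open>T\<close>.

  So the perturbation has order \<open>M = T \<epsilon> powr m\<close>, and the bounds reproduce themselves
  (\<open>bootstrap_constants\<close>) as long as \<open>M\<close> is small compared with \<open>\<epsilon>\<close> and \<open>T\<^sup>2 M powr (r - 1)\<close> is small.
  These are the conditions that \<open>T \<epsilon> powr (m - 1)\<close> and \<open>T powr (r + 1) * \<epsilon> powr (m (r - 1))\<close> are
  small; which one is the stricter depends on the exponents, and this gives the three regimes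
  (\<open>lifespan_exponent\<close>).

  The bounds confine all Picard iterates to a region where \<open>F\<close> is Lipschitz, so that the iterates
  converge on the whole time interval in a norm with an exponential weight in time. For a
  classical solution the source must be continuously differentiable in space. The space
  derivatives of the iterates obey a linear recursion with uniformly convergent coefficients and
  converge as well (\<open>src_x_uniformly_convergent\<close>). It is used here that \<open>F\<close> is continuously
  differentiable, as it is for \<open>p, q, r > 1\<close>. One space derivative of the source suffices for all
  second derivatives of \<open>u\<close>, since differentiating a characteristic integral in time yields the
  source itself and the integral of its space derivative (\<open>ray_dt\<close>).
\<close>

section \<open>Integration along characteristics\<close>

definition strip :: "real \<Rightarrow> (real \<times> real) set" where
  "strip T = UNIV \<times> {0..T}"

text \<open>
  Functions on the strip are taken uncurried from here on. The speeds \<open>1\<close> and \<open>-1\<close> give the two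
  families of characteristics through a point; the speed \<open>0\<close> gives plain integration in time, so
  that one set of lemmas covers Duhamel's formula for the derivatives as well as the recovery of
  the function from its time derivative.
\<close>

definition ray :: "real \<Rightarrow> (real \<times> real \<Rightarrow> real) \<Rightarrow> real \<times> real \<Rightarrow> real" where
  "ray \<sigma> G p = integral {0..snd p} (\<lambda>s. G (fst p + \<sigma> * (snd p - s), s))"

text \<open>
  The regularity carried through the iteration: \<open>H\<close> is the classical space derivative of \<open>G\<close>, and both
  are continuous. All first derivatives of the characteristic integrals of \<open>G\<close> can be expressed
  through \<open>G\<close> and \<open>H\<close>.
\<close>

definition C1x :: "real \<Rightarrow> (real \<times> real \<Rightarrow> real) \<Rightarrow> (real \<times> real \<Rightarrow> real) \<Rightarrow> bool" where
  "C1x T G H \<longleftrightarrow> continuous_on (strip T) G \<and> continuous_on (strip T) H \<and>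
     (\<forall>x. \<forall>t\<in>{0..T}. ((\<lambda>y. G (y, t)) has_real_derivative H (x, t)) (at x))"

lemma mem_strip [simp]: "(x, t) \<in> strip T \<longleftrightarrow> 0 \<le> t \<and> t \<le> T"
  by (simp add: strip_def)

lemma continuous_on_compose_strip:
  assumes "continuous_on (strip T) G" "continuous_on S a" "continuous_on S b"
    "\<And>s. s \<in> S \<Longrightarrow> 0 \<le> b s \<and> b s \<le> T"
  shows "continuous_on S (\<lambda>s. G (a s, b s))"
  by (rule continuous_on_compose2[OF assms(1)]) (use assms in \<open>auto intro!: continuous_intros\<close>)

lemma ray_integrand_continuous:
  assumes "continuous_on (strip T) G" "t \<le> T"
  shows "continuous_on {0..t} (\<lambda>s. G (x + \<sigma> * (t - s), s))"
  by (rule continuous_on_compose_strip[OF assms(1)]) (use assms in \<open>auto intro!: continuous_intros\<close>)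

lemma ray_initial [simp]: "ray \<sigma> G (x, 0) = 0"
  by (simp add: ray_def)

text \<open>
  In the coordinate that is constant along a characteristic, integration along the characteristic
  is integration in time with the other variable fixed. This reduces continuity and
  differentiability to speed \<open>0\<close>.
\<close>

lemma ray_shear: "ray \<sigma> G (x, t) = ray 0 (\<lambda>p. G (fst p - \<sigma> * snd p, snd p)) (x + \<sigma> * t, t)"
  by (simp add: ray_def algebra_simps)

lemma ray0_continuous:
  assumes G: "continuous_on (strip T) G"
  shows "continuous_on (strip T) (ray 0 G)"
proof -
  \<comment> \<open>Freezing the integrand after the time of evaluation makes the interval of integration constant.\<close>
  have eq: "ray 0 G p = integral {0..T} (\<lambda>s. G (fst p, min s (snd p))) - (T - snd p) * G p"
    if "p \<in> strip T" for p
  proof -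
    obtain x t where p: "p = (x, t)" and t: "0 \<le> t" "t \<le> T"
      using \<open>p \<in> strip T\<close> by (cases p) auto
    have c: "continuous_on {0..T} (\<lambda>s. G (x, min s t))"
      by (rule continuous_on_compose_strip[OF G]) (use t in \<open>auto intro!: continuous_intros\<close>)
    have "integral {0..T} (\<lambda>s. G (x, min s t))
        = integral {0..t} (\<lambda>s. G (x, min s t)) + integral {t..T} (\<lambda>s. G (x, min s t))"
      using Henstock_Kurzweil_Integration.integral_combine[OF t integrable_continuous_real[OF c]] by simp
    also have "integral {0..t} (\<lambda>s. G (x, min s t)) = integral {0..t} (\<lambda>s. G (x, s))"
      by (rule integral_cong) auto
    also have "integral {t..T} (\<lambda>s. G (x, min s t)) = integral {t..T} (\<lambda>s. G (x, t))"
      by (rule integral_cong) auto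
    finally show ?thesis
      using t by (simp add: p ray_def)
  qed
  have "continuous_on (strip T \<times> cbox 0 T) (\<lambda>(p, s). G (fst p, min s (snd p)))"
    unfolding case_prod_beta
    by (rule continuous_on_compose_strip[OF G]) (auto intro!: continuous_intros)
  then have "continuous_on (strip T) (\<lambda>p. integral (cbox 0 T) (\<lambda>s. G (fst p, min s (snd p))))"
    by (rule integral_continuous_on_param)
  then have "continuous_on (strip T)
      (\<lambda>p. integral {0..T} (\<lambda>s. G (fst p, min s (snd p))) - (T - snd p) * G p)"
    using G by (auto intro!: continuous_intros)
  then show ?thesis
    using eq by (simp cong: continuous_on_cong)
qed

lemma ray_continuous:
  assumes G: "continuous_on (strip T) G"
  shows "continuous_on (strip T) (ray \<sigma> G)"
proof -
  have "continuous_on (strip T) (\<lambda>p. G (fst p - \<sigma> * snd p, snd p))"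
    by (rule continuous_on_compose_strip[OF G]) (auto intro!: continuous_intros)
  then have "continuous_on (strip T) (ray 0 (\<lambda>p. G (fst p - \<sigma> * snd p, snd p)))"
    by (rule ray0_continuous)
  then have "continuous_on (strip T)
      (\<lambda>p. ray 0 (\<lambda>p. G (fst p - \<sigma> * snd p, snd p)) (fst p + \<sigma> * snd p, snd p))"
    by (rule continuous_on_compose_strip) (auto intro!: continuous_intros)
  then show ?thesis
    by (simp add: ray_shear[of \<sigma> G "fst p" "snd p" for p, unfolded prod.collapse])
qed

lemma ray_C1x:
  assumes "C1x T G H"
  shows "C1x T (ray \<sigma> G) (ray \<sigma> H)"
  unfolding C1x_def
proof (intro conjI allI ballI)
  have G: "continuous_on (strip T) G" and H: "continuous_on (strip T) H"
    and D: "\<And>x t. t \<in> {0..T} \<Longrightarrow> ((\<lambda>y. G (y, t)) has_real_derivative H (x, t)) (at x)"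
    using assms by (auto simp: C1x_def)
  show "continuous_on (strip T) (ray \<sigma> G)" "continuous_on (strip T) (ray \<sigma> H)"
    by (auto intro: ray_continuous G H)
  fix x t :: real assume t: "t \<in> {0..T}"
  have "((\<lambda>y. integral (cbox 0 t) (\<lambda>s. G (y + \<sigma> * (t - s), s))) has_real_derivative
      integral (cbox 0 t) (\<lambda>s. H (x + \<sigma> * (t - s), s))) (at x within UNIV)"
  proof (rule leibniz_rule_field_derivative)
    fix y s :: real assume "s \<in> cbox 0 t"
    then have "s \<in> {0..T}" using t by auto
    from D[OF this, of "y + \<sigma> * (t - s)"]
    show "((\<lambda>y. G (y + \<sigma> * (t - s), s)) has_real_derivative H (y + \<sigma> * (t - s), s)) (at y within UNIV)"
      by (simp add: DERIV_shift)
  next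
    fix y show "(\<lambda>s. G (y + \<sigma> * (t - s), s)) integrable_on cbox 0 t"
      using ray_integrand_continuous[OF G, of t y \<sigma>] t integrable_continuous_real by auto
  next
    show "continuous_on (UNIV \<times> cbox 0 t) (\<lambda>(y, s). H (y + \<sigma> * (t - s), s))"
      unfolding case_prod_beta
      by (rule continuous_on_compose_strip[OF H]) (use t in \<open>auto intro!: continuous_intros\<close>)
  qed auto
  then show "((\<lambda>y. ray \<sigma> G (y, t)) has_real_derivative ray \<sigma> H (x, t)) (at x)"
    by (simp add: ray_def)
qed

lemma ray0_dt:
  assumes G: "continuous_on (strip T) G" and t: "t \<in> {0..T}"
  shows "((\<lambda>s. ray 0 G (x, s)) has_real_derivative G (x, t)) (at t within {0..T})"
proof -
  have "continuous_on {0..T} (\<lambda>s. G (x, s))"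
    by (rule continuous_on_compose_strip[OF G]) (auto intro!: continuous_intros)
  from integral_has_real_derivative[OF this t] show ?thesis
    by (simp add: ray_def)
qed

text \<open>
  The formula is the chain rule for the sheared function: its derivative in the characteristic
  coordinate is the integral of \<open>H\<close>, its derivative in time is the integrand at the endpoint, and
  the latter is continuous in both variables, so that the function is differentiable jointly in
  both variables.
\<close>

lemma ray_dt:
  assumes C: "C1x T G H" and t: "t \<in> {0..T}"
  shows "((\<lambda>s. ray \<sigma> G (x, s)) has_real_derivative G (x, t) + \<sigma> * ray \<sigma> H (x, t))
           (at t within {0..T})"
proof -
  define G' where "G' = (\<lambda>p. G (fst p - \<sigma> * snd p, snd p))"
  define H' where "H' = (\<lambda>p. H (fst p - \<sigma> * snd p, snd p))"
  have G: "continuous_on (strip T) G" and H: "continuous_on (strip T) H"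
    and D: "\<And>x t. t \<in> {0..T} \<Longrightarrow> ((\<lambda>y. G (y, t)) has_real_derivative H (x, t)) (at x)"
    using C by (auto simp: C1x_def)
  have G': "continuous_on (strip T) G'" and H': "continuous_on (strip T) H'"
    unfolding G'_def H'_def
    by (auto intro!: continuous_on_compose_strip[OF G] continuous_on_compose_strip[OF H] continuous_intros)
  have C': "C1x T G' H'"
    unfolding C1x_def
  proof (intro conjI G' H' allI ballI)
    fix x t assume "t \<in> {0..T}"
    from D[OF this, of "x + (- \<sigma> * t)"]
    show "((\<lambda>y. G' (y, t)) has_real_derivative H' (x, t)) (at x)"
      unfolding DERIV_shift by (simp add: G'_def H'_def)
  qed
  define k where "k \<xi> s = ray 0 G' (\<xi>, s)" for \<xi> s
  let ?y = "x + \<sigma> * t"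
  have tot: "((\<lambda>(\<xi>, s). k \<xi> s) has_derivative
     (\<lambda>(a, b). ray 0 H' (?y, t) * a + blinfun_scaleR_left (G' (?y, t)) b)) (at (?y, t) within UNIV \<times> {0..T})"
  proof (rule has_derivative_partialsI)
    show "((\<lambda>\<xi>. k \<xi> t) has_derivative (*) (ray 0 H' (?y, t))) (at ?y within UNIV)"
      using ray_C1x[OF C', of 0] t
      by (auto simp: C1x_def k_def has_field_derivative_def)
    show "(k \<xi> has_derivative blinfun_apply (blinfun_scaleR_left (G' (\<xi>, s)))) (at s within {0..T})"
      if "s \<in> {0..T}" for \<xi> s
    proof -
      have "blinfun_apply (blinfun_scaleR_left (G' (\<xi>, s))) = (*) (G' (\<xi>, s))"
        by (auto simp: fun_eq_iff mult.commute)
      with ray0_dt[OF G' that, of \<xi>] show ?thesis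
        by (simp add: k_def[abs_def] has_field_derivative_def)
    qed
    have eq: "(\<lambda>(\<xi>, s). blinfun_scaleR_left (G' (\<xi>, s))) = (\<lambda>p. blinfun_scaleR_left (G' p))"
      by auto
    have "continuous_on (UNIV \<times> {0..T}) (\<lambda>p. blinfun_scaleR_left (G' p))"
      using G' by (auto simp: strip_def intro!: continuous_intros)
    then show "continuous (at (?y, t) within UNIV \<times> {0..T}) (\<lambda>(\<xi>, s). blinfun_scaleR_left (G' (\<xi>, s)))"
      unfolding eq using t by (simp add: continuous_on_eq_continuous_within)
  qed (use t in auto)
  have lin: "((\<lambda>s. (x + \<sigma> * s, s)) has_derivative (\<lambda>h. (\<sigma> * h, h))) (at t within {0..T})"
    by (auto intro!: derivative_eq_intros)
  have "((\<lambda>s. k (x + \<sigma> * s) s) has_derivative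
       (\<lambda>h. ray 0 H' (?y, t) * (\<sigma> * h) + h * G' (?y, t))) (at t within {0..T})"
    using has_derivative_in_compose[OF lin has_derivative_subset[OF tot]]
    by (auto simp: image_subset_iff)
  moreover have "(\<lambda>s. k (x + \<sigma> * s) s) = (\<lambda>s. ray \<sigma> G (x, s))"
    by (simp add: k_def G'_def ray_shear[of \<sigma> G])
  moreover have "ray 0 H' (?y, t) = ray \<sigma> H (x, t)" "G' (?y, t) = G (x, t)"
    by (simp_all add: G'_def H'_def ray_shear[of \<sigma> H])
  ultimately have "((\<lambda>s. ray \<sigma> G (x, s)) has_derivative
       (\<lambda>h. ray \<sigma> H (x, t) * (\<sigma> * h) + h * G (x, t))) (at t within {0..T})"
    by simp
  then show ?thesis
    unfolding has_field_derivative_def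
    by (rule has_derivative_eq_rhs) (simp add: fun_eq_iff algebra_simps)
qed

lemma ray_diff:
  assumes "continuous_on (strip T) G" "continuous_on (strip T) G'" "t \<le> T"
  shows "ray \<sigma> G (x, t) - ray \<sigma> G' (x, t) = ray \<sigma> (\<lambda>p. G p - G' p) (x, t)"
  unfolding ray_def fst_conv snd_conv
  by (rule integral_diff[symmetric];
      rule integrable_continuous_real; rule ray_integrand_continuous) (use assms in auto)

text \<open>
  The gain \<open>1 / l\<close> makes characteristic integration as contractive as desired on any time interval,
  once functions are measured against a sufficiently steep exponential.
\<close>

lemma ray_exp_bound:
  assumes G: "continuous_on (strip T) G" and t: "0 \<le> t" "t \<le> T" and l: "l > 0" and c: "c \<ge> 0"
    and b: "\<And>x t. 0 \<le> t \<Longrightarrow> t \<le> T \<Longrightarrow> \<bar>G (x, t)\<bar> \<le> c * exp (l * t)"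
  shows "\<bar>ray \<sigma> G (x, t)\<bar> \<le> c / l * exp (l * t)"
proof -
  have i: "((\<lambda>s. c * exp (l * s)) has_integral (c / l * exp (l * t) - c / l * exp (l * 0))) {0..t}"
    using t l by (intro fundamental_theorem_of_calculus)
      (auto intro!: derivative_eq_intros simp: has_real_derivative_iff_has_vector_derivative[symmetric])
  have "norm (integral {0..t} (\<lambda>s. G (x + \<sigma> * (t - s), s))) \<le> integral {0..t} (\<lambda>s. c * exp (l * s))"
    using ray_integrand_continuous[OF G t(2)] i t b
    by (intro integral_norm_bound_integral) (auto intro: integrable_continuous_real)
  also have "\<dots> \<le> c / l * exp (l * t)"
    unfolding integral_unique[OF i] using c l by simp
  finally show ?thesis by (simp add: ray_def)
qed

text \<open>
  A characteristic, or a vertical line, that enters the inside of the light cone meets the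
  neighbourhood of the cone in one bounded time window only; outside that window the smaller bound
  \<open>a\<close> applies.
\<close>

lemma integral_bound_off_window:
  fixes g :: "real \<Rightarrow> real"
  assumes g: "continuous_on {0..t} g" and t: "0 \<le> t" and ab: "0 \<le> a" "0 \<le> b" "c \<le> d"
    and out: "\<And>s. s \<in> {0..t} \<Longrightarrow> s < c \<or> d < s \<Longrightarrow> \<bar>g s\<bar> \<le> a"
    and ins: "\<And>s. s \<in> {0..t} \<Longrightarrow> \<bar>g s\<bar> \<le> a + b"
  shows "\<bar>integral {0..t} g\<bar> \<le> a * t + b * (d - c)"
proof -
  let ?h = "\<lambda>s. if s \<in> {c..d} then b else 0"
  have int: "{c..d} \<inter> {0..t} = {max c 0..min d t}" by auto
  have hi: "?h integrable_on {0..t}"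
    unfolding integrable_restrict_Int int by (rule integrable_const_ivl)
  have "integral {0..t} ?h = integral ({c..d} \<inter> {0..t}) (\<lambda>_. b)"
    by (rule integral_restrict_Int)
  also have "\<dots> \<le> b * (d - c)"
    using ab by (auto simp: int content_real_if mult.commute intro!: mult_left_mono)
  finally have h: "integral {0..t} ?h \<le> b * (d - c)" .
  have "norm (integral {0..t} g) \<le> integral {0..t} (\<lambda>s. a + ?h s)"
  proof (rule integral_norm_bound_integral)
    show "(\<lambda>s. a + ?h s) integrable_on {0..t}"
      by (intro integrable_add hi) auto
    fix s assume "s \<in> {0..t}"
    then show "norm (g s) \<le> a + ?h s"
      using out[of s] ins[of s] ab by (cases "s \<in> {c..d}") auto
  qed (use g integrable_continuous_real in auto)
  also have "\<dots> = a * t + integral {0..t} ?h"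
    using t by (subst integral_add[OF _ hi]) auto
  finally show ?thesis using h by simp
qed

section \<open>Duhamel's formula\<close>

text \<open>
  With zero initial data and source \<open>G\<close>, d'Alembert's formula gives \<open>(u\<^sub>t + u\<^sub>x) / 2\<close> and \<open>(u\<^sub>t - u\<^sub>x) / 2\<close>
  as half the integrals of \<open>G\<close> along the two characteristics. The solution itself is the time
  integral of \<open>u\<^sub>t\<close>, which avoids a double integral over the backward triangle.
\<close>

definition duhamel_t :: "(real \<times> real \<Rightarrow> real) \<Rightarrow> real \<times> real \<Rightarrow> real" where
  "duhamel_t G p = (ray 1 G p + ray (- 1) G p) / 2"

definition duhamel_x :: "(real \<times> real \<Rightarrow> real) \<Rightarrow> real \<times> real \<Rightarrow> real" where
  "duhamel_x G p = (ray 1 G p - ray (- 1) G p) / 2"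

definition duhamel :: "(real \<times> real \<Rightarrow> real) \<Rightarrow> real \<times> real \<Rightarrow> real" where
  "duhamel G = ray 0 (duhamel_t G)"

lemma duhamel_initial [simp]:
  "duhamel G (x, 0) = 0" "duhamel_t G (x, 0) = 0" "duhamel_x G (x, 0) = 0"
  by (simp_all add: duhamel_def duhamel_t_def duhamel_x_def)

lemma duhamel_continuous:
  assumes "continuous_on (strip T) G"
  shows "continuous_on (strip T) (duhamel_t G)" "continuous_on (strip T) (duhamel_x G)"
    "continuous_on (strip T) (duhamel G)"
proof -
  show t: "continuous_on (strip T) (duhamel_t G)" and "continuous_on (strip T) (duhamel_x G)"
    unfolding duhamel_t_def[abs_def] duhamel_x_def[abs_def]
    by (intro continuous_intros ray_continuous assms; simp)+
  show "continuous_on (strip T) (duhamel G)"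
    unfolding duhamel_def by (rule ray_continuous[OF t])
qed

lemma duhamel_t_C1x: "C1x T G H \<Longrightarrow> C1x T (duhamel_t G) (duhamel_t H)"
  and duhamel_x_C1x: "C1x T G H \<Longrightarrow> C1x T (duhamel_x G) (duhamel_x H)"
  using ray_C1x[of T G H 1] ray_C1x[of T G H "- 1"]
  by (auto simp: C1x_def duhamel_t_def[abs_def] duhamel_x_def[abs_def]
      intro!: continuous_intros derivative_eq_intros)

lemma duhamel_t_dt:
  assumes "C1x T G H" "t \<in> {0..T}"
  shows "((\<lambda>s. duhamel_t G (x, s)) has_real_derivative G (x, t) + duhamel_x H (x, t)) (at t within {0..T})"
  unfolding duhamel_t_def duhamel_x_def
  by (rule derivative_eq_intros ray_dt[OF assms] refl | simp add: field_simps)+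

lemma duhamel_x_dt:
  assumes "C1x T G H" "t \<in> {0..T}"
  shows "((\<lambda>s. duhamel_x G (x, s)) has_real_derivative duhamel_t H (x, t)) (at t within {0..T})"
  unfolding duhamel_t_def duhamel_x_def
  by (rule derivative_eq_intros ray_dt[OF assms] refl | simp add: field_simps)+

lemma duhamel_dt:
  assumes "continuous_on (strip T) G" "t \<in> {0..T}"
  shows "((\<lambda>s. duhamel G (x, s)) has_real_derivative duhamel_t G (x, t)) (at t within {0..T})"
  unfolding duhamel_def by (rule ray0_dt[OF duhamel_continuous(1)]) (use assms in auto)

text \<open>
  The space derivative of the time integral of \<open>u\<^sub>t\<close> is the time integral of \<open>u\<^sub>t\<^sub>x\<close>. That function is
  also the time derivative of \<open>duhamel_x G\<close>, which vanishes initially, so the fundamental theorem of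
  calculus identifies the two.
\<close>

lemma duhamel_C1x:
  assumes C: "C1x T G H"
  shows "C1x T (duhamel G) (duhamel_x G)"
proof -
  have "ray 0 (duhamel_t H) (x, t) = duhamel_x G (x, t)" if "t \<in> {0..T}" for x t
  proof -
    have "((\<lambda>s. duhamel_t H (x, s)) has_integral duhamel_x G (x, t) - duhamel_x G (x, 0)) {0..t}"
    proof (rule fundamental_theorem_of_calculus)
      fix s assume "s \<in> {0..t}"
      then have "s \<in> {0..T}" "{0..t} \<subseteq> {0..T}" using that by auto
      then show "((\<lambda>s. duhamel_x G (x, s)) has_vector_derivative duhamel_t H (x, s)) (at s within {0..t})"
        using has_field_derivative_subset[OF duhamel_x_dt[OF C]]
        by (simp add: has_real_derivative_iff_has_vector_derivative)
    qed (use that in auto)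
    then show ?thesis by (simp add: ray_def integral_unique)
  qed
  moreover have "C1x T (duhamel G) (ray 0 (duhamel_t H))"
    unfolding duhamel_def by (intro ray_C1x duhamel_t_C1x C)
  moreover have "continuous_on (strip T) (duhamel_x G)"
    using C duhamel_continuous by (auto simp: C1x_def)
  ultimately show ?thesis by (simp add: C1x_def)
qed

lemma duhamel_diff:
  assumes G: "continuous_on (strip T) G" "continuous_on (strip T) G'" and p: "p \<in> strip T"
  shows "duhamel_t G p - duhamel_t G' p = duhamel_t (\<lambda>p. G p - G' p) p"
    "duhamel_x G p - duhamel_x G' p = duhamel_x (\<lambda>p. G p - G' p) p"
    "duhamel G p - duhamel G' p = duhamel (\<lambda>p. G p - G' p) p"
proof -
  have *: "ray \<sigma> G q - ray \<sigma> G' q = ray \<sigma> (\<lambda>p. G p - G' p) q" if "q \<in> strip T" for q \<sigma>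
    using ray_diff[OF G, of "snd q" \<sigma> "fst q"] that by (cases q) auto
  have t: "duhamel_t G q - duhamel_t G' q = duhamel_t (\<lambda>p. G p - G' p) q" if "q \<in> strip T" for q
    by (simp add: duhamel_t_def *[symmetric] that) (simp add: field_simps)
  show "duhamel_t G p - duhamel_t G' p = duhamel_t (\<lambda>p. G p - G' p) p" using t p .
  show "duhamel_x G p - duhamel_x G' p = duhamel_x (\<lambda>p. G p - G' p) p"
    by (simp add: duhamel_x_def *[symmetric] p) (simp add: field_simps)
  obtain x \<tau> where p': "p = (x, \<tau>)" "0 \<le> \<tau>" "\<tau> \<le> T" using p by (cases p) auto
  have "duhamel G p - duhamel G' p = ray 0 (\<lambda>p. duhamel_t G p - duhamel_t G' p) p"
    unfolding duhamel_def p'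
    by (rule ray_diff) (use p' duhamel_continuous G in auto)
  also have "\<dots> = duhamel (\<lambda>p. G p - G' p) p"
    unfolding duhamel_def ray_def
    by (rule integral_cong) (use p' t in auto)
  finally show "duhamel G p - duhamel G' p = duhamel (\<lambda>p. G p - G' p) p" .
qed

text \<open>
  A bound in the supremum norm with the weight \<open>exp (- l t)\<close>.
\<close>

definition exp_bounded :: "real \<Rightarrow> real \<Rightarrow> real \<Rightarrow> (real \<times> real \<Rightarrow> real) \<Rightarrow> bool" where
  "exp_bounded T l c G \<longleftrightarrow> (\<forall>x t. 0 \<le> t \<longrightarrow> t \<le> T \<longrightarrow> \<bar>G (x, t)\<bar> \<le> c * exp (l * t))"

lemma abs_half_le:
  fixes a b k :: real
  assumes "\<bar>a\<bar> \<le> k" "\<bar>b\<bar> \<le> k"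
  shows "\<bar>(a + b) / 2\<bar> \<le> k" "\<bar>(a - b) / 2\<bar> \<le> k"
  using assms by (simp_all add: abs_le_iff)

lemma duhamel_exp_bounded:
  assumes G: "continuous_on (strip T) G" and l: "l \<ge> 1" and c: "c \<ge> 0" and b: "exp_bounded T l c G"
  shows "exp_bounded T l (c / l) (duhamel_t G)" "exp_bounded T l (c / l) (duhamel_x G)"
    "exp_bounded T l (c / l) (duhamel G)"
proof -
  have r: "\<bar>ray \<sigma> G (x, t)\<bar> \<le> c / l * exp (l * t)" if "0 \<le> t" "t \<le> T" for \<sigma> x t
    by (rule ray_exp_bound[OF G that]) (use l c b in \<open>auto simp: exp_bounded_def\<close>)
  show t: "exp_bounded T l (c / l) (duhamel_t G)"
    unfolding exp_bounded_def duhamel_t_def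
  proof (intro allI impI)
    fix x t assume "0 \<le> t" "t \<le> T"
    then show "\<bar>(ray 1 G (x, t) + ray (- 1) G (x, t)) / 2\<bar> \<le> c / l * exp (l * t)"
      by (intro abs_half_le r)
  qed
  show "exp_bounded T l (c / l) (duhamel_x G)"
    unfolding exp_bounded_def duhamel_x_def
  proof (intro allI impI)
    fix x t assume "0 \<le> t" "t \<le> T"
    then show "\<bar>(ray 1 G (x, t) - ray (- 1) G (x, t)) / 2\<bar> \<le> c / l * exp (l * t)"
      by (intro abs_half_le r)
  qed
  show "exp_bounded T l (c / l) (duhamel G)"
    unfolding exp_bounded_def
  proof (intro allI impI)
    fix x t assume t': "0 \<le> t" "t \<le> T"
    have "\<bar>duhamel G (x, t)\<bar> \<le> c / l / l * exp (l * t)"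
      unfolding duhamel_def
      by (rule ray_exp_bound[OF duhamel_continuous(1)[OF G] t'])
         (use l c t in \<open>auto simp: exp_bounded_def\<close>)
    also have "\<dots> \<le> c / l * exp (l * t)"
    proof -
      have "c / l / l \<le> c / l / 1" using l c by (intro divide_left_mono) auto
      then have "c / l / l \<le> c / l" by simp
      then show ?thesis by (rule mult_right_mono) simp
    qed
    finally show "\<bar>duhamel G (x, t)\<bar> \<le> c / l * exp (l * t)" .
  qed
qed

section \<open>Bounds near and inside the light cone\<close>

text \<open>
  The bound \<open>a\<close> is for the neighbourhood of the light cone, \<open>b\<close> for the inside. The data have their
  support in \<open>[-R, R]\<close>, and a profile travelling with speed one stays in the neighbourhood.
\<close>

definition cone_bounded :: "real \<Rightarrow> real \<Rightarrow> real \<Rightarrow> real \<Rightarrow> (real \<times> real \<Rightarrow> real) \<Rightarrow> bool" where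
  "cone_bounded T R a b G \<longleftrightarrow> (\<forall>x t. 0 \<le> t \<longrightarrow> t \<le> T \<longrightarrow>
     (t - R \<le> \<bar>x\<bar> \<longrightarrow> \<bar>G (x, t)\<bar> \<le> a) \<and> (\<bar>x\<bar> \<le> t - R \<longrightarrow> \<bar>G (x, t)\<bar> \<le> b) \<and>
     (t + R \<le> \<bar>x\<bar> \<longrightarrow> G (x, t) = 0))"

lemma cone_boundedD:
  assumes "cone_bounded T R a b G" "0 \<le> t" "t \<le> T"
  shows "t - R \<le> \<bar>x\<bar> \<Longrightarrow> \<bar>G (x, t)\<bar> \<le> a" "\<bar>x\<bar> \<le> t - R \<Longrightarrow> \<bar>G (x, t)\<bar> \<le> b"
    "t + R \<le> \<bar>x\<bar> \<Longrightarrow> G (x, t) = 0"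
  using assms by (auto simp: cone_bounded_def)

text \<open>
  A backward characteristic from a point near the cone never enters the inside, since going back
  by a time \<open>h\<close> changes \<open>|x|\<close> by at most \<open>h\<close>.
\<close>

lemma ray_near_cone:
  assumes G: "continuous_on (strip T) G" and B: "cone_bounded T R a b G"
    and t: "0 \<le> t" "t \<le> T" and \<sigma>: "\<bar>\<sigma>\<bar> \<le> 1" and a: "0 \<le> a" and x: "t - R \<le> \<bar>x\<bar>"
  shows "\<bar>ray \<sigma> G (x, t)\<bar> \<le> a * T"
proof -
  have "\<bar>integral {0..t} (\<lambda>s. G (x + \<sigma> * (t - s), s))\<bar> \<le> a * t + 0 * (0 - 0)"
  proof (rule integral_bound_off_window)
    fix s assume s: "s \<in> {0..t}"
    have "\<bar>\<sigma> * (t - s)\<bar> \<le> t - s"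
      using s \<sigma> by (auto simp: abs_mult intro: mult_left_le_one_le)
    then have "s - R \<le> \<bar>x + \<sigma> * (t - s)\<bar>" using x by linarith
    then show "\<bar>G (x + \<sigma> * (t - s), s)\<bar> \<le> a + 0" "\<bar>G (x + \<sigma> * (t - s), s)\<bar> \<le> a"
      using B s t by (auto simp: cone_bounded_def)
  qed (use G t a in \<open>auto intro: ray_integrand_continuous\<close>)
  also have "\<dots> \<le> a * T" using a t by (simp add: mult_left_mono)
  finally show ?thesis by (simp add: ray_def)
qed

lemma ray_outside_cone:
  assumes B: "cone_bounded T R a b G"
    and t: "0 \<le> t" "t \<le> T" and \<sigma>: "\<bar>\<sigma>\<bar> \<le> 1" and x: "t + R \<le> \<bar>x\<bar>"
  shows "ray \<sigma> G (x, t) = 0"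
proof -
  have "integral {0..t} (\<lambda>s. G (x + \<sigma> * (t - s), s)) = integral {0..t} (\<lambda>s. 0)"
  proof (rule integral_cong)
    fix s assume s: "s \<in> {0..t}"
    have "\<bar>\<sigma> * (t - s)\<bar> \<le> t - s"
      using s \<sigma> by (auto simp: abs_mult intro: mult_left_le_one_le)
    then have "s + R \<le> \<bar>x + \<sigma> * (t - s)\<bar>" using x by linarith
    then show "G (x + \<sigma> * (t - s), s) = 0"
      using B s t by (auto simp: cone_bounded_def)
  qed
  then show ?thesis by (simp add: ray_def)
qed

text \<open>
  Followed backwards from inside the cone, a characteristic reaches the neighbourhood of the cone,
  crosses it transversally in time \<open>R\<close>, and then stays in the region where the source vanishes.
  Hence \<open>a\<close> enters with the factor \<open>R\<close> instead of \<open>T\<close>.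
\<close>

lemma ray_inside_cone:
  assumes G: "continuous_on (strip T) G" and B: "cone_bounded T R a b G"
    and t: "0 \<le> t" "t \<le> T" and \<sigma>: "\<sigma> = 1 \<or> \<sigma> = -1" and ab: "0 \<le> a" "0 \<le> b" and R: "0 \<le> R"
    and x: "\<bar>x\<bar> \<le> t - R"
  shows "\<bar>ray \<sigma> G (x, t)\<bar> \<le> R * a + T * b"
proof -
  \<comment> \<open>The time at which the characteristic passes from the exterior into the neighbourhood of the cone.\<close>
  let ?c = "(\<sigma> * x + t - R) / 2"
  have "\<bar>integral {0..t} (\<lambda>s. G (x + \<sigma> * (t - s), s))\<bar> \<le> b * t + a * (?c + R - ?c)"
  proof (rule integral_bound_off_window)
    fix s assume s: "s \<in> {0..t}"
    have B': "\<And>y. s - R \<le> \<bar>y\<bar> \<Longrightarrow> \<bar>G (y, s)\<bar> \<le> a" "\<And>y. \<bar>y\<bar> \<le> s - R \<Longrightarrow> \<bar>G (y, s)\<bar> \<le> b"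
        "\<And>y. s + R \<le> \<bar>y\<bar> \<Longrightarrow> \<bar>G (y, s)\<bar> \<le> b"
      using B s t ab by (auto simp: cone_bounded_def)
    have "s - R \<le> \<bar>x + \<sigma> * (t - s)\<bar> \<or> \<bar>x + \<sigma> * (t - s)\<bar> \<le> s - R" by linarith
    then show "\<bar>G (x + \<sigma> * (t - s), s)\<bar> \<le> b + a"
      using B'(1,2)[of "x + \<sigma> * (t - s)"] ab by linarith
    show "\<bar>G (x + \<sigma> * (t - s), s)\<bar> \<le> b" if "s < ?c \<or> ?c + R < s"
    proof -
      have "\<bar>x + \<sigma> * (t - s)\<bar> \<le> s - R \<or> s + R \<le> \<bar>x + \<sigma> * (t - s)\<bar>"
        using that
      proof
        assume "s < ?c"
        then have "s + R \<le> \<sigma> * (x + \<sigma> * (t - s))"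
          using \<sigma> by (elim disjE) (auto simp: field_simps)
        also have "\<dots> \<le> \<bar>x + \<sigma> * (t - s)\<bar>"
          using \<sigma> by (elim disjE) auto
        finally show ?thesis ..
      next
        assume "?c + R < s"
        then have "x + \<sigma> * (t - s) \<le> s - R" "- (x + \<sigma> * (t - s)) \<le> s - R"
          using \<sigma> x s by (auto simp: field_simps abs_le_iff)
        then show ?thesis by (simp add: abs_le_iff)
      qed
      then show ?thesis using B' by blast
    qed
  qed (use G t ab R in \<open>auto intro: ray_integrand_continuous\<close>)
  also have "\<dots> \<le> R * a + T * b" using ab t mult_right_mono[of t T b] by (simp add: mult.commute)
  finally show ?thesis by (simp add: ray_def)
qed

lemma duhamel_t_cone_bounded:
  assumes G: "continuous_on (strip T) G" and B: "cone_bounded T R a b G"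
    and ab: "0 \<le> a" "0 \<le> b" and R: "0 \<le> R"
  shows "cone_bounded T R (a * T) (R * a + T * b) (duhamel_t G)"
  unfolding cone_bounded_def
proof (intro allI impI conjI)
  fix x t assume t: "0 \<le> t" "t \<le> T"
  show "\<bar>duhamel_t G (x, t)\<bar> \<le> a * T" if "t - R \<le> \<bar>x\<bar>"
    using ray_near_cone[OF G B t _ ab(1) that, of 1] ray_near_cone[OF G B t _ ab(1) that, of "-1"]
    by (simp add: duhamel_t_def)
  show "\<bar>duhamel_t G (x, t)\<bar> \<le> R * a + T * b" if "\<bar>x\<bar> \<le> t - R"
    using ray_inside_cone[OF G B t _ ab R that, of 1] ray_inside_cone[OF G B t _ ab R that, of "-1"]
    by (simp add: duhamel_t_def)
  show "duhamel_t G (x, t) = 0" if "t + R \<le> \<bar>x\<bar>"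
    using ray_outside_cone[OF B t _ that, of 1] ray_outside_cone[OF B t _ that, of "-1"]
    by (simp add: duhamel_t_def)
qed

text \<open>
  The vertical line over \<open>x\<close> is near the cone for a time \<open>2 R\<close>, where the time derivative is at most \<open>a
  T\<close>, and inside it for a time at most \<open>T\<close>, where the time derivative is at most \<open>R a + T b\<close>.
\<close>

lemma duhamel_cone_bounded:
  assumes G: "continuous_on (strip T) G" and B: "cone_bounded T R a b G"
    and ab: "0 \<le> a" "0 \<le> b" and R: "0 \<le> R" and T: "0 \<le> T"
  shows "cone_bounded T R (3 * R * a * T + b * T\<^sup>2) (3 * R * a * T + b * T\<^sup>2) (duhamel G)"
proof -
  let ?N = "R * a + T * b"
  note B' = duhamel_t_cone_bounded[OF G B ab R]
  have N: "0 \<le> ?N" "0 \<le> a * T" using ab R T by auto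
  have bd: "\<bar>duhamel G (x, t)\<bar> \<le> 3 * R * a * T + b * T\<^sup>2" if t: "0 \<le> t" "t \<le> T" for x t
  proof -
    have "\<bar>integral {0..t} (\<lambda>s. duhamel_t G (x + 0 * (t - s), s))\<bar>
        \<le> ?N * t + a * T * ((\<bar>x\<bar> + R) - (\<bar>x\<bar> - R))"
    proof (rule integral_bound_off_window)
      show "continuous_on {0..t} (\<lambda>s. duhamel_t G (x + 0 * (t - s), s))"
        by (rule ray_integrand_continuous[OF duhamel_continuous(1)[OF G] t(2)])
      fix s assume s: "s \<in> {0..t}"
      have B'': "s - R \<le> \<bar>x\<bar> \<Longrightarrow> \<bar>duhamel_t G (x, s)\<bar> \<le> a * T"
        "\<bar>x\<bar> \<le> s - R \<Longrightarrow> \<bar>duhamel_t G (x, s)\<bar> \<le> ?N"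
        "s + R \<le> \<bar>x\<bar> \<Longrightarrow> \<bar>duhamel_t G (x, s)\<bar> \<le> ?N"
        using B' s t N by (auto simp: cone_bounded_def)
      show "\<bar>duhamel_t G (x + 0 * (t - s), s)\<bar> \<le> ?N + a * T"
        using B''(1,2) N by (cases "s - R \<le> \<bar>x\<bar>") auto
      show "\<bar>duhamel_t G (x + 0 * (t - s), s)\<bar> \<le> ?N" if "s < \<bar>x\<bar> - R \<or> \<bar>x\<bar> + R < s"
        using B'' that by auto
    qed (use t N R in auto)
    also have "\<dots> \<le> ?N * T + a * T * (2 * R)"
      using t N mult_left_mono[of t T ?N] by simp
    finally show ?thesis
      by (simp add: duhamel_def ray_def power2_eq_square algebra_simps)
  qed
  have "duhamel G (x, t) = 0" if "0 \<le> t" "t \<le> T" "t + R \<le> \<bar>x\<bar>" for x t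
    unfolding duhamel_def by (rule ray_outside_cone[OF B']) (use that in auto)
  with bd show ?thesis by (auto simp: cone_bounded_def)
qed

section \<open>A contraction up to vanishing errors\<close>

text \<open>
  The iteration contracts the space derivatives only up to errors that vanish in the limit,
  because the derivatives of the nonlinearity are merely continuous and not Lipschitz (the
  exponents may be smaller than two). Such a sequence still converges: once the error is below a
  quarter of the distance already reached, a step reduces the distance by the factor \<open>3/4\<close>.
\<close>

lemma uniformly_convergent_almost_contraction:
  fixes h :: "nat \<Rightarrow> real \<times> real \<Rightarrow> real"
  assumes l: "l \<ge> 0" and bd: "\<And>n. exp_bounded T l Z (h n)"
    and step: "\<And>e. e > 0 \<Longrightarrow> \<exists>N. \<forall>m\<ge>N. \<forall>n\<ge>N. \<forall>c\<ge>0.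
        exp_bounded T l c (\<lambda>p. h m p - h n p) \<longrightarrow>
        exp_bounded T l (c / 2 + e) (\<lambda>p. h (Suc m) p - h (Suc n) p)"
  shows "uniformly_convergent_on (strip T) h"
proof (rule Cauchy_uniformly_convergent, rule uniformly_Cauchy_onI')
  define Z' where "Z' = 2 * \<bar>Z\<bar> + 1"
  have Z': "Z' > 0" by (simp add: Z'_def)
  have geo: "\<exists>N. \<forall>m\<ge>N. \<forall>n\<ge>N. exp_bounded T l ((3/4)^k * Z') (\<lambda>p. h m p - h n p)" for k
  proof (induction k)
    case 0
    have "exp_bounded T l Z' (\<lambda>p. h m p - h n p)" for m n
      unfolding exp_bounded_def
    proof (intro allI impI)
      fix x t assume t: "0 \<le> t" "t \<le> T"
      have "\<bar>h m (x, t) - h n (x, t)\<bar> \<le> 2 * (Z * exp (l * t))"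
      proof -
        have "\<bar>h m (x, t)\<bar> \<le> Z * exp (l * t)" "\<bar>h n (x, t)\<bar> \<le> Z * exp (l * t)"
          using bd[of m] bd[of n] t unfolding exp_bounded_def by blast+
        then show ?thesis by linarith
      qed
      also have "\<dots> = (2 * Z) * exp (l * t)" by simp
      also have "\<dots> \<le> Z' * exp (l * t)"
        by (rule mult_right_mono) (simp_all add: Z'_def)
      finally show "\<bar>h m (x, t) - h n (x, t)\<bar> \<le> Z' * exp (l * t)" .
    qed
    then show ?case by simp
  next
    case (Suc k)
    then obtain N where N: "\<forall>m\<ge>N. \<forall>n\<ge>N. exp_bounded T l ((3/4)^k * Z') (\<lambda>p. h m p - h n p)" by auto
    have "(3/4)^k * Z' / 4 > 0" using Z' by simp
    from step[OF this] obtain N' where N': "\<forall>m\<ge>N'. \<forall>n\<ge>N'. \<forall>c\<ge>0.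
        exp_bounded T l c (\<lambda>p. h m p - h n p) \<longrightarrow>
        exp_bounded T l (c / 2 + (3/4)^k * Z' / 4) (\<lambda>p. h (Suc m) p - h (Suc n) p)" by auto
    have "exp_bounded T l ((3/4)^Suc k * Z') (\<lambda>p. h m p - h n p)"
      if mn: "m \<ge> Suc (max N N')" "n \<ge> Suc (max N N')" for m n
    proof -
      obtain m' n' where "m = Suc m'" "n = Suc n'" "m' \<ge> max N N'" "n' \<ge> max N N'"
        using mn by (metis Suc_le_D Suc_le_mono)
      moreover from this have
        "exp_bounded T l ((3/4)^k * Z' / 2 + (3/4)^k * Z' / 4) (\<lambda>p. h (Suc m') p - h (Suc n') p)"
        using N N' Z' by (metis (no_types, lifting) less_imp_le max.bounded_iff mult_nonneg_nonneg
            zero_le_divide_iff zero_le_numeral zero_le_power)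
      moreover have "(3/4)^k * Z' / 2 + (3/4)^k * Z' / 4 = (3/4)^Suc k * Z'" by simp
      ultimately show ?thesis by metis
    qed
    then show ?case by blast
  qed
  fix e :: real assume e: "e > 0"
  define e' where "e' = e / (Z' * exp (l * T))"
  have "e' > 0" using e Z' by (simp add: e'_def)
  then obtain k where k: "(3/4::real)^k < e'"
    using real_arch_pow_inv[of e' "3/4"] by auto
  obtain N where N: "\<forall>m\<ge>N. \<forall>n\<ge>N. exp_bounded T l ((3/4)^k * Z') (\<lambda>p. h m p - h n p)"
    using geo[of k] by auto
  have "dist (h m p) (h n p) < e" if "p \<in> strip T" "m \<ge> N" "n \<ge> N" for p m n
  proof -
    obtain x t where p: "p = (x, t)" "0 \<le> t" "t \<le> T" using \<open>p \<in> strip T\<close> by (cases p) auto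
    have "\<bar>h m p - h n p\<bar> \<le> (3/4)^k * Z' * exp (l * t)"
      using N that p by (auto simp: exp_bounded_def)
    also have "\<dots> \<le> (3/4)^k * Z' * exp (l * T)"
      using p l Z' by (intro mult_left_mono) (auto intro: mult_left_mono)
    also have "\<dots> < e' * (Z' * exp (l * T))"
      using k Z' by (simp add: mult.assoc)
    also have "\<dots> = e" using Z' by (simp add: e'_def)
    finally show ?thesis by (simp add: dist_real_def)
  qed
  then show "\<exists>M. \<forall>x\<in>strip T. \<forall>m\<ge>M. \<forall>n>m. dist (h m x) (h n x) < e"
    by (meson le_trans less_imp_le)
qed

section \<open>Picard iteration for the source term\<close>

lemma uniform_limit_Pair:
  assumes "uniform_limit A f f' F" "uniform_limit A g g' F"
  shows "uniform_limit A (\<lambda>n x. (f n x, g n x)) (\<lambda>x. (f' x, g' x)) F"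
proof (rule uniform_limitI)
  fix e :: real assume "e > 0"
  then have "e / 2 > 0" by simp
  from uniform_limitD[OF assms(1) this] uniform_limitD[OF assms(2) this]
  show "\<forall>\<^sub>F n in F. \<forall>x\<in>A. dist (f n x, g n x) (f' x, g' x) < e"
  proof eventually_elim
    case (elim n)
    show ?case
    proof
      fix x assume "x \<in> A"
      have "dist (f n x, g n x) (f' x, g' x) \<le> dist (f n x) (f' x) + dist (g n x) (g' x)"
        unfolding dist_Pair_Pair by (rule sqrt_sum_squares_le_sum) auto
      also have "\<dots> < e / 2 + e / 2"
        using elim \<open>x \<in> A\<close> by (intro add_strict_mono) auto
      finally show "dist (f n x, g n x) (f' x, g' x) < e" by simp
    qed
  qed
qed

lemma exp_bounded_const:
  assumes "l \<ge> 0" "\<And>p. p \<in> strip T \<Longrightarrow> \<bar>G p\<bar> \<le> c"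
  shows "exp_bounded T l c G"
  unfolding exp_bounded_def
proof (intro allI impI)
  fix x t :: real assume t: "0 \<le> t" "t \<le> T"
  then have G: "\<bar>G (x, t)\<bar> \<le> c" by (intro assms) auto
  then have "c * 1 \<le> c * exp (l * t)"
    using assms(1) t by (intro mult_left_mono) auto
  with G show "\<bar>G (x, t)\<bar> \<le> c * exp (l * t)" by simp
qed

lemma exp_bounded_bound:
  assumes "exp_bounded T l c G" "l \<ge> 0" "c \<ge> 0" "p \<in> strip T"
  shows "\<bar>G p\<bar> \<le> c * exp (l * T)"
proof -
  obtain x t where p: "p = (x, t)" "0 \<le> t" "t \<le> T" using assms(4) by (cases p) auto
  then have "\<bar>G p\<bar> \<le> c * exp (l * t)" using assms(1) by (simp add: exp_bounded_def)
  also have "\<dots> \<le> c * exp (l * T)"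
    using p assms by (intro mult_left_mono) (auto intro: mult_left_mono)
  finally show ?thesis .
qed

lemma duhamel_bound:
  assumes G: "continuous_on (strip T) G" and c: "\<And>p. p \<in> strip T \<Longrightarrow> \<bar>G p\<bar> \<le> c" "c \<ge> 0"
    and p: "p \<in> strip T"
  shows "\<bar>duhamel G p\<bar> \<le> c * exp T" "\<bar>duhamel_t G p\<bar> \<le> c * exp T" "\<bar>duhamel_x G p\<bar> \<le> c * exp T"
proof -
  have "exp_bounded T 1 c G" using c by (intro exp_bounded_const) auto
  from duhamel_exp_bounded[OF G _ c(2) this]
  show "\<bar>duhamel G p\<bar> \<le> c * exp T" "\<bar>duhamel_t G p\<bar> \<le> c * exp T" "\<bar>duhamel_x G p\<bar> \<le> c * exp T"
    using exp_bounded_bound[OF _ _ c(2) p, of 1] by auto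
qed

lemma uniform_limit_duhamel:
  assumes h: "\<And>n. continuous_on (strip T) (h n)" and ul: "uniform_limit (strip T) h l sequentially"
  shows "uniform_limit (strip T) (\<lambda>n. duhamel (h n)) (duhamel l) sequentially"
    "uniform_limit (strip T) (\<lambda>n. duhamel_t (h n)) (duhamel_t l) sequentially"
    "uniform_limit (strip T) (\<lambda>n. duhamel_x (h n)) (duhamel_x l) sequentially"
proof -
  have l: "continuous_on (strip T) l"
    by (rule uniform_limit_theorem[OF _ ul]) (auto simp: h)
  have *: "\<forall>\<^sub>F n in sequentially. \<forall>p\<in>strip T. dist (duhamel (h n) p) (duhamel l p) < e \<and>
      dist (duhamel_t (h n) p) (duhamel_t l p) < e \<and> dist (duhamel_x (h n) p) (duhamel_x l p) < e"
    if e: "e > 0" for e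
  proof -
    have "e / (2 * exp T) > 0" using e by simp
    from uniform_limitD[OF ul this] show ?thesis
    proof eventually_elim
      case (elim n)
      have c: "continuous_on (strip T) (\<lambda>p. h n p - l p)"
        using h l by (auto intro!: continuous_intros)
      have b: "\<bar>h n p - l p\<bar> \<le> e / (2 * exp T)" if "p \<in> strip T" for p
        using elim that by (auto simp: dist_real_def less_imp_le)
      have lt: "e / (2 * exp T) * exp T < e" and nn: "e / (2 * exp T) \<ge> 0" using e by auto
      show ?case
        unfolding dist_real_def
        by (intro ballI conjI; subst duhamel_diff[OF h l], assumption,
            rule le_less_trans[OF _ lt], rule duhamel_bound[OF c b nn], assumption+)
    qed
  qed
  show "uniform_limit (strip T) (\<lambda>n. duhamel (h n)) (duhamel l) sequentially"
    by (rule uniform_limitI, drule *, erule eventually_mono) blast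
  show "uniform_limit (strip T) (\<lambda>n. duhamel_t (h n)) (duhamel_t l) sequentially"
    by (rule uniform_limitI, drule *, erule eventually_mono) blast
  show "uniform_limit (strip T) (\<lambda>n. duhamel_x (h n)) (duhamel_x l) sequentially"
    by (rule uniform_limitI, drule *, erule eventually_mono) blast
qed

lemma uniform_limit_C1x:
  assumes C: "\<And>n. C1x T (h n) (k n)" and h: "uniform_limit (strip T) h G sequentially"
    and k: "uniform_limit (strip T) k H sequentially"
  shows "C1x T G H"
  unfolding C1x_def
proof (intro conjI allI ballI)
  show "continuous_on (strip T) G"
    by (rule uniform_limit_theorem[OF _ h]) (use C in \<open>auto simp: C1x_def\<close>)
  show "continuous_on (strip T) H"
    by (rule uniform_limit_theorem[OF _ k]) (use C in \<open>auto simp: C1x_def\<close>)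
  fix x t assume t: "t \<in> {0..T}"
  have "\<exists>g. \<forall>y\<in>UNIV. (\<lambda>n. h n (y, t)) \<longlonglongrightarrow> g y \<and>
      (g has_derivative (*) (H (y, t))) (at y within UNIV)"
  proof (rule has_derivative_sequence)
    show "((\<lambda>y. h n (y, t)) has_derivative (*) (k n (y, t))) (at y within UNIV)" for n y
      using C[of n] t by (auto simp: C1x_def has_field_derivative_def)
    show "\<forall>\<^sub>F n in sequentially. \<forall>y\<in>UNIV. \<forall>h. norm (k n (y, t) * h - H (y, t) * h) \<le> e * norm h"
      if "e > 0" for e
      using uniform_limitD[OF k that]
    proof eventually_elim
      case (elim n)
      show ?case
      proof (intro ballI allI)
        fix y d :: real
        have "\<bar>k n (y, t) - H (y, t)\<bar> \<le> e" using elim t by (auto simp: dist_real_def less_imp_le)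
        then have "\<bar>k n (y, t) - H (y, t)\<bar> * \<bar>d\<bar> \<le> e * \<bar>d\<bar>" by (rule mult_right_mono) simp
        then show "norm (k n (y, t) * d - H (y, t) * d) \<le> e * norm d"
          by (simp add: abs_mult[symmetric] left_diff_distrib)
      qed
    qed
    show "(\<lambda>n. h n (0, t)) \<longlonglongrightarrow> G (0, t)"
      using tendsto_uniform_limitI[OF h, of "(0, t)"] t by simp
  qed auto
  then obtain g where g: "\<And>y. (\<lambda>n. h n (y, t)) \<longlonglongrightarrow> g y"
    "\<And>y. (g has_derivative (*) (H (y, t))) (at y)" by auto
  have "g y = G (y, t)" for y
    using LIMSEQ_unique[OF g(1)] tendsto_uniform_limitI[OF h, of "(y, t)"] t by simp
  then have "g = (\<lambda>y. G (y, t))" by auto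
  with g(2) show "((\<lambda>y. G (y, t)) has_real_derivative H (x, t)) (at x)"
    by (simp add: has_field_derivative_def)
qed

text \<open>
  The equation \<open>u\<^sub>t\<^sub>t - u\<^sub>x\<^sub>x = F(u, u\<^sub>t)\<close> whose free solution is the sum of the two compactly supported
  travelling waves \<open>\<alpha>(x + t)\<close> and \<open>\<beta>(x - t)\<close>. The total differentiability of \<open>F\<close> is stated as a chain
  rule, the form in which it is used. The number \<open>\<delta>\<close> bounds the free solution and its first
  derivatives, \<open>M\<close> the perturbation and \<open>N\<close> its time derivative inside the cone; \<open>a\<close> and \<open>b\<close> bound the
  source near and inside the cone. The inequalities between them say that the bounds on the source
  reproduce themselves. All values of \<open>u\<close> and \<open>u\<^sub>t\<close> then lie in \<open>[-1, 1]\<close>, where \<open>F\<close> is Lipschitz.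
\<close>

locale semilinear_wave =
  fixes F F1 F2 :: "real \<Rightarrow> real \<Rightarrow> real"
    and \<alpha> \<alpha>1 \<alpha>2 \<beta> \<beta>1 \<beta>2 :: "real \<Rightarrow> real"
    and T R a b \<delta> M N :: real
  assumes chain: "\<And>f g f' g' x. (f has_real_derivative f') (at x) \<Longrightarrow> (g has_real_derivative g') (at x) \<Longrightarrow>
      ((\<lambda>y. F (f y) (g y)) has_real_derivative F1 (f x) (g x) * f' + F2 (f x) (g x) * g') (at x)"
    and contF: "continuous_on UNIV (\<lambda>(u, v). F u v)"
    and contF1: "continuous_on UNIV (\<lambda>(u, v). F1 u v)"
    and contF2: "continuous_on UNIV (\<lambda>(u, v). F2 u v)"
    and F00: "F 0 0 = 0"
    and \<alpha>: "\<And>y. (\<alpha> has_real_derivative \<alpha>1 y) (at y)" "\<And>y. (\<alpha>1 has_real_derivative \<alpha>2 y) (at y)"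
      "continuous_on UNIV \<alpha>2" "bounded (range \<alpha>2)"
    and \<beta>: "\<And>y. (\<beta> has_real_derivative \<beta>1 y) (at y)" "\<And>y. (\<beta>1 has_real_derivative \<beta>2 y) (at y)"
      "continuous_on UNIV \<beta>2" "bounded (range \<beta>2)"
    and supp: "\<And>y. R \<le> \<bar>y\<bar> \<Longrightarrow> \<alpha> y = 0 \<and> \<alpha>1 y = 0 \<and> \<beta> y = 0 \<and> \<beta>1 y = 0"
    and small: "\<And>y. \<bar>\<alpha> y\<bar> \<le> \<delta> / 2 \<and> \<bar>\<alpha>1 y\<bar> \<le> \<delta> / 2 \<and> \<bar>\<beta> y\<bar> \<le> \<delta> / 2 \<and> \<bar>\<beta>1 y\<bar> \<le> \<delta> / 2"
    and T: "T > 0" and R: "R \<ge> 0" and ab: "a \<ge> 0" "b \<ge> 0"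
    and M: "3 * R * a * T + b * T\<^sup>2 \<le> M" and N: "R * a + T * b \<le> N"
    and aT: "a * T \<le> \<delta>" and M\<delta>: "M \<le> \<delta>" and \<delta>: "2 * \<delta> \<le> 1" and N1: "N \<le> 1"
    and near: "\<And>u v. \<bar>u\<bar> \<le> 2 * \<delta> \<Longrightarrow> \<bar>v\<bar> \<le> 2 * \<delta> \<Longrightarrow> \<bar>F u v\<bar> \<le> a"
    and inner: "\<And>u v. \<bar>u\<bar> \<le> M \<Longrightarrow> \<bar>v\<bar> \<le> N \<Longrightarrow> \<bar>F u v\<bar> \<le> b"
begin

text \<open>
  The solution of the linear problem with source \<open>G\<close> and its derivatives, as functions of \<open>G\<close> and of
  the space derivative \<open>H\<close> of \<open>G\<close>. The first derivatives depend on \<open>G\<close> alone.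
\<close>

definition sol :: "(real \<times> real \<Rightarrow> real) \<Rightarrow> real \<times> real \<Rightarrow> real" where
  "sol G p = \<alpha> (fst p + snd p) + \<beta> (fst p - snd p) + duhamel G p"

definition sol_t :: "(real \<times> real \<Rightarrow> real) \<Rightarrow> real \<times> real \<Rightarrow> real" where
  "sol_t G p = \<alpha>1 (fst p + snd p) - \<beta>1 (fst p - snd p) + duhamel_t G p"

definition sol_x :: "(real \<times> real \<Rightarrow> real) \<Rightarrow> real \<times> real \<Rightarrow> real" where
  "sol_x G p = \<alpha>1 (fst p + snd p) + \<beta>1 (fst p - snd p) + duhamel_x G p"

definition sol_tx :: "(real \<times> real \<Rightarrow> real) \<Rightarrow> real \<times> real \<Rightarrow> real" where
  "sol_tx H p = \<alpha>2 (fst p + snd p) - \<beta>2 (fst p - snd p) + duhamel_t H p"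

definition sol_xx :: "(real \<times> real \<Rightarrow> real) \<Rightarrow> real \<times> real \<Rightarrow> real" where
  "sol_xx H p = \<alpha>2 (fst p + snd p) + \<beta>2 (fst p - snd p) + duhamel_x H p"

lemma profile_continuous:
  "continuous_on UNIV \<alpha>" "continuous_on UNIV \<alpha>1" "continuous_on UNIV \<beta>" "continuous_on UNIV \<beta>1"
  using \<alpha> \<beta> by (auto intro!: DERIV_continuous_on)

lemma compose_continuous:
  fixes k :: "real \<Rightarrow> real"
  assumes "continuous_on UNIV k" "continuous_on S f"
  shows "continuous_on S (\<lambda>x. k (f x))"
  by (rule continuous_on_compose2[OF assms]) auto

lemma sol_continuous:
  assumes "continuous_on (strip T) G"
  shows "continuous_on (strip T) (sol G)" "continuous_on (strip T) (sol_t G)"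
    "continuous_on (strip T) (sol_x G)" "continuous_on (strip T) (sol_tx G)"
    "continuous_on (strip T) (sol_xx G)"
  unfolding sol_def[abs_def] sol_t_def[abs_def] sol_x_def[abs_def] sol_tx_def[abs_def] sol_xx_def[abs_def]
  by (intro continuous_on_add continuous_on_diff duhamel_continuous assms
      compose_continuous[OF profile_continuous(1)] compose_continuous[OF profile_continuous(2)]
      compose_continuous[OF profile_continuous(3)] compose_continuous[OF profile_continuous(4)]
      compose_continuous[OF \<alpha>(3)] compose_continuous[OF \<beta>(3)] continuous_on_fst continuous_on_snd
      continuous_on_id)+

lemma plus_shift:
  assumes "\<And>y. (k has_real_derivative k' y) (at y)"
  shows "((\<lambda>x. k (x + t)) has_real_derivative k' (x + t)) (at x)"
    "((\<lambda>x. k (x - t)) has_real_derivative k' (x - t)) (at x)"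
    "((\<lambda>s. k (x + s)) has_real_derivative k' (x + t)) (at t within S)"
    "((\<lambda>s. k (x - s)) has_real_derivative - k' (x - t)) (at t within S)"
proof -
  show "((\<lambda>x. k (x + t)) has_real_derivative k' (x + t)) (at x)"
    using assms DERIV_shift by blast
  show "((\<lambda>x. k (x - t)) has_real_derivative k' (x - t)) (at x)"
    using assms[of "x + (- t)"] unfolding DERIV_shift by simp
  have "((\<lambda>s. x + s) has_real_derivative 1) (at t within S)"
    "((\<lambda>s. x - s) has_real_derivative - 1) (at t within S)"
    by (auto intro!: derivative_eq_intros)
  from this[THEN DERIV_chain2[OF assms]]
  show "((\<lambda>s. k (x + s)) has_real_derivative k' (x + t)) (at t within S)"
    "((\<lambda>s. k (x - s)) has_real_derivative - k' (x - t)) (at t within S)"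
    by simp_all
qed

lemma sol_C1x:
  assumes C: "C1x T G H"
  shows "C1x T (sol G) (sol_x G)" "C1x T (sol_t G) (sol_tx H)" "C1x T (sol_x G) (sol_xx H)"
proof -
  have GH: "continuous_on (strip T) G" "continuous_on (strip T) H"
    using C by (auto simp: C1x_def)
  have d': "((\<lambda>y. duhamel G (y, t)) has_real_derivative duhamel_x G (x, t)) (at x)"
    "((\<lambda>y. duhamel_t G (y, t)) has_real_derivative duhamel_t H (x, t)) (at x)"
    "((\<lambda>y. duhamel_x G (y, t)) has_real_derivative duhamel_x H (x, t)) (at x)"
    if "0 \<le> t" "t \<le> T" for x t
    using duhamel_C1x[OF C] duhamel_t_C1x[OF C] duhamel_x_C1x[OF C] that by (auto simp: C1x_def)
  note p1 = DERIV_add[OF DERIV_add[OF plus_shift(1)[OF \<alpha>(1)] plus_shift(2)[OF \<beta>(1)]] d'(1)]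
  note p2 = DERIV_add[OF DERIV_diff[OF plus_shift(1)[OF \<alpha>(2)] plus_shift(2)[OF \<beta>(2)]] d'(2)]
  note p3 = DERIV_add[OF DERIV_add[OF plus_shift(1)[OF \<alpha>(2)] plus_shift(2)[OF \<beta>(2)]] d'(3)]
  show "C1x T (sol G) (sol_x G)"
    unfolding C1x_def using sol_continuous[OF GH(1)] p1 by (auto simp: sol_def sol_x_def)
  show "C1x T (sol_t G) (sol_tx H)"
    unfolding C1x_def using sol_continuous[OF GH(1)] sol_continuous[OF GH(2)] p2
    by (auto simp: sol_t_def sol_tx_def)
  show "C1x T (sol_x G) (sol_xx H)"
    unfolding C1x_def using sol_continuous[OF GH(1)] sol_continuous[OF GH(2)] p3
    by (auto simp: sol_x_def sol_xx_def)
qed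

lemma sol_dt:
  assumes C: "C1x T G H" and t: "t \<in> {0..T}"
  shows "((\<lambda>s. sol G (x, s)) has_real_derivative sol_t G (x, t)) (at t within {0..T})"
    "((\<lambda>s. sol_t G (x, s)) has_real_derivative G (x, t) + sol_xx H (x, t)) (at t within {0..T})"
    "((\<lambda>s. sol_x G (x, s)) has_real_derivative sol_tx H (x, t)) (at t within {0..T})"
proof -
  have G: "continuous_on (strip T) G" using C by (auto simp: C1x_def)
  note p1 = DERIV_add[OF DERIV_add[OF plus_shift(3)[OF \<alpha>(1)] plus_shift(4)[OF \<beta>(1)]] duhamel_dt[OF G t]]
  note p2 = DERIV_add[OF DERIV_diff[OF plus_shift(3)[OF \<alpha>(2)] plus_shift(4)[OF \<beta>(2)]] duhamel_t_dt[OF C t]]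
  note p3 = DERIV_add[OF DERIV_add[OF plus_shift(3)[OF \<alpha>(2)] plus_shift(4)[OF \<beta>(2)]] duhamel_x_dt[OF C t]]
  show "((\<lambda>s. sol G (x, s)) has_real_derivative sol_t G (x, t)) (at t within {0..T})"
    using p1 by (simp add: sol_def sol_t_def)
  show "((\<lambda>s. sol_t G (x, s)) has_real_derivative G (x, t) + sol_xx H (x, t)) (at t within {0..T})"
    unfolding sol_t_def sol_xx_def fst_conv snd_conv by (rule DERIV_cong[OF p2]) simp
  show "((\<lambda>s. sol_x G (x, s)) has_real_derivative sol_tx H (x, t)) (at t within {0..T})"
    using p3 by (simp add: sol_x_def sol_tx_def)
qed

text \<open>
  The unknown of the fixed point problem is the source \<open>F(u, u\<^sub>t)\<close>. By the chain rule its space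
  derivative depends on \<open>H\<close> in an affine way, with coefficients that depend on \<open>G\<close> alone.
\<close>

definition step :: "(real \<times> real \<Rightarrow> real) \<Rightarrow> real \<times> real \<Rightarrow> real" where
  "step G p = F (sol G p) (sol_t G p)"

definition step_x :: "(real \<times> real \<Rightarrow> real) \<Rightarrow> (real \<times> real \<Rightarrow> real) \<Rightarrow> real \<times> real \<Rightarrow> real" where
  "step_x G H p = F1 (sol G p) (sol_t G p) * sol_x G p + F2 (sol G p) (sol_t G p) * sol_tx H p"

lemma compose2_continuous:
  fixes k :: "real \<Rightarrow> real \<Rightarrow> real"
  assumes "continuous_on UNIV (\<lambda>(u, v). k u v)" "continuous_on S f" "continuous_on S g"
  shows "continuous_on S (\<lambda>x. k (f x) (g x))"
  using continuous_on_compose2[OF assms(1) continuous_on_Pair[OF assms(2,3)]] by simp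

lemma step_continuous: "continuous_on (strip T) G \<Longrightarrow> continuous_on (strip T) (step G)"
  unfolding step_def[abs_def] by (intro compose2_continuous[OF contF] sol_continuous)

lemma step_C1x:
  assumes C: "C1x T G H"
  shows "C1x T (step G) (step_x G H)"
proof -
  have G: "continuous_on (strip T) G" and H: "continuous_on (strip T) H"
    using C by (auto simp: C1x_def)
  have "continuous_on (strip T) (step_x G H)"
    unfolding step_x_def[abs_def]
    by (intro continuous_on_add continuous_on_mult compose2_continuous[OF contF1]
        compose2_continuous[OF contF2] sol_continuous G H)
  then show ?thesis
    using sol_C1x(1,2)[OF C] step_continuous[OF G]
    unfolding C1x_def step_def[of G "(x, t)" for x t] step_x_def[of G H "(x, t)" for x t]
    by (intro conjI allI ballI chain) auto
qed

definition admissible :: "(real \<times> real \<Rightarrow> real) \<Rightarrow> bool" where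
  "admissible G \<longleftrightarrow> continuous_on (strip T) G \<and> cone_bounded T R a b G"

lemma admissible_bound: "admissible G \<Longrightarrow> p \<in> strip T \<Longrightarrow> \<bar>G p\<bar> \<le> a + b"
proof -
  assume G: "admissible G" and "p \<in> strip T"
  then obtain x t where p: "p = (x, t)" "0 \<le> t" "t \<le> T" by (cases p) auto
  have "\<bar>G (x, t)\<bar> \<le> a \<or> \<bar>G (x, t)\<bar> \<le> b"
    using G p(2,3) linear[of "t - R" "\<bar>x\<bar>"] unfolding admissible_def cone_bounded_def by blast
  with ab show ?thesis by (auto simp: p(1))
qed

lemma free_small: "\<bar>\<alpha> y + \<beta> z\<bar> \<le> \<delta>" "\<bar>\<alpha>1 y - \<beta>1 z\<bar> \<le> \<delta>" "\<bar>\<alpha>1 y + \<beta>1 z\<bar> \<le> \<delta>"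
proof -
  have half: "\<bar>c + d\<bar> \<le> \<delta>" "\<bar>c - d\<bar> \<le> \<delta>" if "\<bar>c\<bar> \<le> \<delta> / 2" "\<bar>d\<bar> \<le> \<delta> / 2" for c d
    using that by linarith+
  show "\<bar>\<alpha> y + \<beta> z\<bar> \<le> \<delta>" by (rule half) (use small in blast)+
  show "\<bar>\<alpha>1 y - \<beta>1 z\<bar> \<le> \<delta>" by (rule half) (use small in blast)+
  show "\<bar>\<alpha>1 y + \<beta>1 z\<bar> \<le> \<delta>" by (rule half) (use small in blast)+
qed

lemma sol_near:
  assumes "admissible G" "0 \<le> t" "t \<le> T" "t - R \<le> \<bar>x\<bar>"
  shows "\<bar>sol G (x, t)\<bar> \<le> 2 * \<delta>" "\<bar>sol_t G (x, t)\<bar> \<le> 2 * \<delta>"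
proof -
  have G: "continuous_on (strip T) G" and B: "cone_bounded T R a b G"
    using assms by (auto simp: admissible_def)
  note D = duhamel_cone_bounded[OF G B ab R less_imp_le[OF T]] duhamel_t_cone_bounded[OF G B ab R]
  have "\<bar>duhamel G (x, t)\<bar> \<le> 3 * R * a * T + b * T\<^sup>2"
    by (rule cone_boundedD(1)[OF D(1) assms(2-4)])
  then show "\<bar>sol G (x, t)\<bar> \<le> 2 * \<delta>"
    using M M\<delta> free_small(1)[of "x + t" "x - t"] by (simp add: sol_def)
  have "\<bar>duhamel_t G (x, t)\<bar> \<le> a * T"
    by (rule cone_boundedD(1)[OF D(2) assms(2-4)])
  then show "\<bar>sol_t G (x, t)\<bar> \<le> 2 * \<delta>"
    using aT free_small(2)[of "x + t" "x - t"] by (simp add: sol_t_def)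
qed

lemma sol_inner:
  assumes "admissible G" "0 \<le> t" "t \<le> T" "\<bar>x\<bar> \<le> t - R"
  shows "\<bar>sol G (x, t)\<bar> \<le> M" "\<bar>sol_t G (x, t)\<bar> \<le> N"
proof -
  have G: "continuous_on (strip T) G" and B: "cone_bounded T R a b G"
    using assms by (auto simp: admissible_def)
  note D = duhamel_cone_bounded[OF G B ab R less_imp_le[OF T]] duhamel_t_cone_bounded[OF G B ab R]
  have "R \<le> \<bar>x + t\<bar>" "R \<le> \<bar>x - t\<bar>" using assms(4) by linarith+
  from this[THEN supp]
  have z: "\<alpha> (x + t) = 0" "\<beta> (x - t) = 0" "\<alpha>1 (x + t) = 0" "\<beta>1 (x - t) = 0"
    by blast+
  have "\<bar>duhamel G (x, t)\<bar> \<le> 3 * R * a * T + b * T\<^sup>2"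
    by (rule cone_boundedD(2)[OF D(1) assms(2-4)])
  then show "\<bar>sol G (x, t)\<bar> \<le> M" using M z by (simp add: sol_def)
  have "\<bar>duhamel_t G (x, t)\<bar> \<le> R * a + T * b"
    by (rule cone_boundedD(2)[OF D(2) assms(2-4)])
  then show "\<bar>sol_t G (x, t)\<bar> \<le> N" using N z by (simp add: sol_t_def)
qed

lemma sol_outside:
  assumes "admissible G" "0 \<le> t" "t \<le> T" "t + R \<le> \<bar>x\<bar>"
  shows "sol G (x, t) = 0" "sol_t G (x, t) = 0"
proof -
  have G: "continuous_on (strip T) G" and B: "cone_bounded T R a b G"
    using assms by (auto simp: admissible_def)
  note D = duhamel_cone_bounded[OF G B ab R less_imp_le[OF T]] duhamel_t_cone_bounded[OF G B ab R]
  have "R \<le> \<bar>x + t\<bar>" "R \<le> \<bar>x - t\<bar>" using assms(2,4) by linarith+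
  from this[THEN supp]
  have "\<alpha> (x + t) = 0" "\<beta> (x - t) = 0" "\<alpha>1 (x + t) = 0" "\<beta>1 (x - t) = 0"
    by blast+
  then show "sol G (x, t) = 0" "sol_t G (x, t) = 0"
    using cone_boundedD(3)[OF D(1) assms(2-4)] cone_boundedD(3)[OF D(2) assms(2-4)]
    by (simp_all add: sol_def sol_t_def)
qed

text \<open>
  The invariance that makes the lifespan long: near the cone \<open>u\<close> and \<open>u\<^sub>t\<close> have the size \<open>\<delta>\<close> of the data,
  whereas inside the cone the free solution vanishes and only the perturbation remains.
\<close>

lemma step_admissible: "admissible G \<Longrightarrow> admissible (step G)"
  unfolding admissible_def[of "step G"] cone_bounded_def
proof (intro conjI allI impI)
  assume A: "admissible G"
  then show "continuous_on (strip T) (step G)"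
    by (auto simp: admissible_def intro: step_continuous)
  fix x t :: real assume t: "0 \<le> t" "t \<le> T"
  show "t - R \<le> \<bar>x\<bar> \<Longrightarrow> \<bar>step G (x, t)\<bar> \<le> a"
    unfolding step_def by (intro near sol_near A t)
  show "\<bar>x\<bar> \<le> t - R \<Longrightarrow> \<bar>step G (x, t)\<bar> \<le> b"
    unfolding step_def by (intro inner sol_inner A t)
  show "t + R \<le> \<bar>x\<bar> \<Longrightarrow> step G (x, t) = 0"
    using sol_outside[OF A t] by (simp add: step_def F00)
qed

lemma sol_unit_box:
  assumes "admissible G" "p \<in> strip T"
  shows "sol G p \<in> {-1..1}" "sol_t G p \<in> {-1..1}"
proof -
  obtain x t where p: "p = (x, t)" "0 \<le> t" "t \<le> T" using assms by (cases p) auto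
  have "t - R \<le> \<bar>x\<bar> \<or> \<bar>x\<bar> \<le> t - R" by linarith
  then have "\<bar>sol G p\<bar> \<le> 1 \<and> \<bar>sol_t G p\<bar> \<le> 1"
  proof
    assume "t - R \<le> \<bar>x\<bar>"
    from sol_near[OF assms(1) p(2,3) this] show ?thesis using \<delta> p(1) by auto
  next
    assume x: "\<bar>x\<bar> \<le> t - R"
    have "M \<le> 1" using M\<delta> \<delta> abs_ge_zero[of "\<alpha> 0"] small[of 0] by linarith
    with sol_inner[OF assms(1) p(2,3) x] show ?thesis using N1 p(1) by auto
  qed
  then show "sol G p \<in> {-1..1}" "sol_t G p \<in> {-1..1}" by auto
qed

lemma partials_bounded:
  "\<exists>K\<ge>0. \<forall>u\<in>{-1..1}. \<forall>v\<in>{-1..1}. \<bar>F1 u v\<bar> \<le> K \<and> \<bar>F2 u v\<bar> \<le> K"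
proof -
  have c: "compact ({-1..1::real} \<times> {-1..1::real})" by (intro compact_Times) auto
  have "bounded ((\<lambda>(u, v). F1 u v) ` ({-1..1} \<times> {-1..1}))"
       "bounded ((\<lambda>(u, v). F2 u v) ` ({-1..1} \<times> {-1..1}))"
    by (intro compact_imp_bounded compact_continuous_image c continuous_on_subset[OF contF1]
        continuous_on_subset[OF contF2]; simp)+
  then obtain K1 K2 where K: "\<And>u v. u \<in> {-1..1} \<Longrightarrow> v \<in> {-1..1} \<Longrightarrow> \<bar>F1 u v\<bar> \<le> K1"
     "\<And>u v. u \<in> {-1..1} \<Longrightarrow> v \<in> {-1..1} \<Longrightarrow> \<bar>F2 u v\<bar> \<le> K2"
    unfolding bounded_iff by (force simp: case_prod_beta)
  have "\<bar>F1 u v\<bar> \<le> \<bar>K1\<bar> + \<bar>K2\<bar> \<and> \<bar>F2 u v\<bar> \<le> \<bar>K1\<bar> + \<bar>K2\<bar>"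
    if "u \<in> {-1..1}" "v \<in> {-1..1}" for u v
    using K[OF that] by linarith
  then show ?thesis by (intro exI[of _ "\<bar>K1\<bar> + \<bar>K2\<bar>"]) simp
qed

lemma F_lipschitz:
  assumes K: "\<And>u v. u \<in> {-1..1} \<Longrightarrow> v \<in> {-1..1} \<Longrightarrow> \<bar>F1 u v\<bar> \<le> K \<and> \<bar>F2 u v\<bar> \<le> K"
    and u: "u \<in> {-1..1}" "u' \<in> {-1..1}" and v: "v \<in> {-1..1}" "v' \<in> {-1..1}"
  shows "\<bar>F u v - F u' v'\<bar> \<le> K * \<bar>u - u'\<bar> + K * \<bar>v - v'\<bar>"
proof -
  have "norm (F u v - F u' v) \<le> K * norm (u - u')"
  proof (rule field_differentiable_bound[where f = "\<lambda>u. F u v" and S = "{-1..1}"])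
    fix z :: real assume "z \<in> {-1..1}"
    then show "norm (F1 z v) \<le> K" using K v by auto
    show "((\<lambda>u. F u v) has_field_derivative F1 z v) (at z within {-1..1})"
      using chain[of "\<lambda>u. u" 1 z "\<lambda>_. v" 0] by (auto intro: has_field_derivative_at_within)
  qed (use u in auto)
  moreover have "norm (F u' v - F u' v') \<le> K * norm (v - v')"
  proof (rule field_differentiable_bound[where f = "\<lambda>v. F u' v" and S = "{-1..1}"])
    fix z :: real assume "z \<in> {-1..1}"
    then show "norm (F2 u' z) \<le> K" using K u by auto
    show "((\<lambda>v. F u' v) has_field_derivative F2 u' z) (at z within {-1..1})"
      using chain[of "\<lambda>_. u'" 0 z "\<lambda>v. v" 1] by (auto intro: has_field_derivative_at_within)
  qed (use v in auto)
  ultimately show ?thesis by simp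
qed

primrec src :: "nat \<Rightarrow> real \<times> real \<Rightarrow> real" where
  "src 0 = (\<lambda>_. 0)"
| "src (Suc n) = step (src n)"

primrec src_x :: "nat \<Rightarrow> real \<times> real \<Rightarrow> real" where
  "src_x 0 = (\<lambda>_. 0)"
| "src_x (Suc n) = step_x (src n) (src_x n)"

lemma src_C1x: "C1x T (src n) (src_x n)"
  by (induction n) (auto intro: step_C1x, simp add: C1x_def)

lemma src_admissible: "admissible (src n)"
  by (induction n) (auto intro: step_admissible, simp add: admissible_def cone_bounded_def ab)

lemma src_continuous: "continuous_on (strip T) (src n)" "continuous_on (strip T) (src_x n)"
  using src_C1x by (auto simp: C1x_def)

text \<open>
  With the weight \<open>exp (l t)\<close> and \<open>l \<ge> 4 K\<close>, where \<open>K\<close> is a Lipschitz constant of \<open>F\<close>, a step halves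
  distances.
\<close>

lemma src_uniformly_convergent: "uniformly_convergent_on (strip T) src"
proof -
  obtain K where K0: "K \<ge> 0" and
    "\<forall>u\<in>{-1..1}. \<forall>v\<in>{-1..1}. \<bar>F1 u v\<bar> \<le> K \<and> \<bar>F2 u v\<bar> \<le> K"
    using partials_bounded by (elim exE conjE)
  note K = this(2)[rule_format]
  define l where "l = 4 * K + 1"
  have l: "l \<ge> 1" "4 * K \<le> l" using K0 by (auto simp: l_def)
  have *: "exp_bounded T l (c / 2) (\<lambda>p. src (Suc m) p - src (Suc n) p)"
    if c: "c \<ge> 0" and b: "exp_bounded T l c (\<lambda>p. src m p - src n p)" for c m n
    unfolding exp_bounded_def
  proof (intro allI impI)
    fix x t :: real assume t: "0 \<le> t" "t \<le> T"
    let ?p = "(x, t)"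
    have p: "?p \<in> strip T" using t by simp
    have cont: "continuous_on (strip T) (\<lambda>p. src m p - src n p)"
      by (intro continuous_intros src_continuous)
    note e = duhamel_exp_bounded[OF cont l(1) c b]
    have "\<bar>sol (src m) ?p - sol (src n) ?p\<bar> \<le> c / l * exp (l * t)"
      "\<bar>sol_t (src m) ?p - sol_t (src n) ?p\<bar> \<le> c / l * exp (l * t)"
      using e t duhamel_diff[OF src_continuous(1)[of m] src_continuous(1)[of n] p]
      by (auto simp: sol_def sol_t_def exp_bounded_def)
    then have "K * \<bar>sol (src m) ?p - sol (src n) ?p\<bar> + K * \<bar>sol_t (src m) ?p - sol_t (src n) ?p\<bar>
        \<le> K * (c / l * exp (l * t)) + K * (c / l * exp (l * t))"
      using K0 by (intro add_mono mult_left_mono) auto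
    also have "\<dots> = (4 * K) * (c / 2 / l * exp (l * t))" by simp
    also have "\<dots> \<le> l * (c / 2 / l * exp (l * t))"
      using l c by (intro mult_right_mono) auto
    also have "\<dots> = c / 2 * exp (l * t)" using l by simp
    finally show "\<bar>src (Suc m) ?p - src (Suc n) ?p\<bar> \<le> c / 2 * exp (l * t)"
      using F_lipschitz[OF K sol_unit_box(1)[OF src_admissible p, of m] sol_unit_box(1)[OF src_admissible p, of n]
        sol_unit_box(2)[OF src_admissible p, of m] sol_unit_box(2)[OF src_admissible p, of n]]
      by (simp add: step_def)
  qed
  show ?thesis
  proof (rule uniformly_convergent_almost_contraction[where l = l and Z = "a + b"])
    show "exp_bounded T l (a + b) (src n)" for n
      using l by (intro exp_bounded_const admissible_bound src_admissible) auto
    fix e :: real assume e: "e > 0"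
    have "exp_bounded T l (c / 2 + e) (\<lambda>p. src (Suc m) p - src (Suc n) p)"
      if "c \<ge> 0" "exp_bounded T l c (\<lambda>p. src m p - src n p)" for c m n
    proof -
      have "c / 2 * exp (l * t) \<le> (c / 2 + e) * exp (l * t)" for t
        by (rule mult_right_mono) (use e in auto)
      with *[OF that] show ?thesis unfolding exp_bounded_def by (meson order_trans)
    qed
    then show "\<exists>N. \<forall>m\<ge>N. \<forall>n\<ge>N. \<forall>c\<ge>0. exp_bounded T l c (\<lambda>p. src m p - src n p) \<longrightarrow>
        exp_bounded T l (c / 2 + e) (\<lambda>p. src (Suc m) p - src (Suc n) p)" by blast
  qed (use l in auto)
qed

lemma sol_uniform_limit:
  assumes G: "uniform_limit (strip T) src G sequentially"
  shows "uniform_limit (strip T) (\<lambda>n. sol (src n)) (sol G) sequentially"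
    "uniform_limit (strip T) (\<lambda>n. sol_t (src n)) (sol_t G) sequentially"
    "uniform_limit (strip T) (\<lambda>n. sol_x (src n)) (sol_x G) sequentially"
  unfolding sol_def[abs_def] sol_t_def[abs_def] sol_x_def[abs_def]
  by (intro uniform_limit_intros uniform_limit_duhamel src_continuous G)+

lemma coefficient_uniform_limit:
  assumes G: "uniform_limit (strip T) src G sequentially"
    and k: "continuous_on UNIV (\<lambda>(u, v). k u v)"
  shows "uniform_limit (strip T) (\<lambda>n p. k (sol (src n) p) (sol_t (src n) p))
    (\<lambda>p. k (sol G p) (sol_t G p)) sequentially"
proof -
  let ?B = "{-1..1::real} \<times> {-1..1::real}"
  have "uniform_limit (strip T)
      (\<lambda>n p. (\<lambda>(u, v). k u v) (sol (src n) p, sol_t (src n) p))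
      (\<lambda>p. (\<lambda>(u, v). k u v) (sol G p, sol_t G p)) sequentially"
  proof (rule uniform_limit_compose_uniformly_continuous_on[where B = ?B])
    show "uniform_limit (strip T) (\<lambda>n p. (sol (src n) p, sol_t (src n) p))
        (\<lambda>p. (sol G p, sol_t G p)) sequentially"
      by (intro uniform_limit_Pair sol_uniform_limit G)
    show "uniformly_continuous_on ?B (\<lambda>(u, v). k u v)"
      by (intro compact_uniformly_continuous continuous_on_subset[OF k] compact_Times) auto
    show "\<forall>\<^sub>F n in sequentially. \<forall>p\<in>strip T. (sol (src n) p, sol_t (src n) p) \<in> ?B"
      using sol_unit_box[OF src_admissible] by auto
  qed (auto intro: closed_Times)
  then show ?thesis by simp
qed

lemma free_tx_bounded: "\<exists>C\<ge>0. \<forall>y z. \<bar>\<alpha>2 y - \<beta>2 z\<bar> \<le> C"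
proof -
  obtain A B where AB: "\<And>y. \<bar>\<alpha>2 y\<bar> \<le> A" "\<And>y. \<bar>\<beta>2 y\<bar> \<le> B"
    using \<alpha>(4) \<beta>(4) unfolding bounded_iff by auto
  have "\<bar>\<alpha>2 y - \<beta>2 z\<bar> \<le> A + B" for y z
    using AB(1)[of y] AB(2)[of z] by linarith
  moreover have "0 \<le> A + B"
    using AB(1)[of 0] AB(2)[of 0] by linarith
  ultimately show ?thesis by blast
qed

text \<open>
  Writing a step as \<open>P n + Q n * u\<^sub>t\<^sub>x\<close>, the coefficients converge uniformly because they depend only
  on the convergent sources and on continuous functions on a compact square. Their fluctuations
  are the vanishing errors; the remaining term contracts as before.
\<close>

lemma src_x_uniformly_convergent: "uniformly_convergent_on (strip T) src_x"
proof -
  obtain K where K0: "K \<ge> 0" and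
    "\<forall>u\<in>{-1..1}. \<forall>v\<in>{-1..1}. \<bar>F1 u v\<bar> \<le> K \<and> \<bar>F2 u v\<bar> \<le> K"
    using partials_bounded by (elim exE conjE)
  note K = this(2)[rule_format]
  obtain C where C: "C \<ge> 0" "\<And>y z. \<bar>\<alpha>2 y - \<beta>2 z\<bar> \<le> C"
    using free_tx_bounded by blast
  obtain G where G: "uniform_limit (strip T) src G sequentially"
    using src_uniformly_convergent by (auto simp: uniformly_convergent_on_def)
  define P where "P n p = F1 (sol (src n) p) (sol_t (src n) p) * sol_x (src n) p" for n p
  define Q where "Q n p = F2 (sol (src n) p) (sol_t (src n) p)" for n p
  define W where "W = \<delta> + (a + b) * exp T"
  define l where "l = 4 * K + 1"
  \<comment> \<open>\<open>Z\<close> absorbs twice the inhomogeneous terms, so that the bound \<open>Z\<close> reproduces itself.\<close>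
  define Z where "Z = 2 * (K * W + K * C)"
  have l: "l \<ge> 1" "4 * K \<le> l" using K0 by (auto simp: l_def)
  have coeff: "\<bar>F1 (sol (src n) p) (sol_t (src n) p)\<bar> \<le> K" "\<bar>Q n p\<bar> \<le> K" if "p \<in> strip T" for n p
    using K[OF sol_unit_box[OF src_admissible that]] by (auto simp: Q_def)
  have W: "\<bar>sol_x (src n) p\<bar> \<le> W" if "p \<in> strip T" for n p
  proof -
    have "\<bar>duhamel_x (src n) p\<bar> \<le> (a + b) * exp T"
      by (rule duhamel_bound(3)[OF src_continuous(1) admissible_bound[OF src_admissible] _ that])
         (use ab in auto)
    then show ?thesis
      using free_small(3)[of "fst p + snd p" "fst p - snd p"] by (simp add: sol_x_def W_def)
  qed
  have W0: "W \<ge> 0"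
    using W[of "(0, 0)" 0] T by (auto intro: order_trans[OF abs_ge_zero])
  have P: "\<bar>P n p\<bar> \<le> K * W" if "p \<in> strip T" for n p
    using coeff(1)[OF that] W[OF that] K0 by (auto simp: P_def abs_mult intro: mult_mono)
  have Z: "Z \<ge> 0" "K * W + K * C = Z / 2" using K0 W0 C by (auto simp: Z_def)
  have next_eq: "src_x (Suc n) p = P n p + Q n p * sol_tx (src_x n) p" for n p
    by (simp add: P_def Q_def step_x_def)
  have tx_bd: "\<bar>sol_tx (src_x n) (x, t)\<bar> \<le> C + Z / l * exp (l * t)"
    if "exp_bounded T l Z (src_x n)" "0 \<le> t" "t \<le> T" for n x t
  proof -
    have "\<bar>duhamel_t (src_x n) (x, t)\<bar> \<le> Z / l * exp (l * t)"
      using duhamel_exp_bounded(1)[OF src_continuous(2) l(1) Z(1) that(1)] that(2,3)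
      by (simp add: exp_bounded_def)
    then show ?thesis
      using C(2)[of "x + t" "x - t"] by (simp add: sol_tx_def)
  qed
  have bd: "exp_bounded T l Z (src_x n)" for n
  proof (induction n)
    case 0
    then show ?case using Z by (simp add: exp_bounded_def)
  next
    case (Suc n)
    show ?case
      unfolding exp_bounded_def
    proof (intro allI impI)
      fix x t :: real assume t: "0 \<le> t" "t \<le> T"
      let ?E = "exp (l * t)"
      have p: "(x, t) \<in> strip T" using t by simp
      have E: "1 \<le> ?E" using l t by simp
      have "\<bar>src_x (Suc n) (x, t)\<bar> \<le> \<bar>P n (x, t)\<bar> + \<bar>Q n (x, t)\<bar> * \<bar>sol_tx (src_x n) (x, t)\<bar>"
        unfolding next_eq by (metis abs_mult abs_triangle_ineq)
      also have "\<dots> \<le> K * W + K * (C + Z / l * ?E)"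
        by (intro add_mono mult_mono P coeff p tx_bd Suc t) (use K0 in auto)
      also have "\<dots> = Z / 2 + (4 * K) * (Z / l / 4 * ?E)"
        using Z(2) by (simp add: algebra_simps)
      also have "\<dots> \<le> Z / 2 * ?E + l * (Z / l / 4 * ?E)"
      proof (rule add_mono)
        show "Z / 2 \<le> Z / 2 * ?E" using Z E mult_left_mono[of 1 ?E "Z / 2"] by simp
        show "(4 * K) * (Z / l / 4 * ?E) \<le> l * (Z / l / 4 * ?E)"
          using l Z by (intro mult_right_mono) auto
      qed
      also have "l * (Z / l / 4 * ?E) = Z / 4 * ?E" using l by simp
      also have "Z / 2 * ?E + Z / 4 * ?E \<le> Z * ?E" using Z by simp
      finally show "\<bar>src_x (Suc n) (x, t)\<bar> \<le> Z * ?E" .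
    qed
  qed
  define B where "B = C + Z / l * exp (l * T) + 1"
  have B: "B > 0" "\<bar>sol_tx (src_x n) p\<bar> \<le> B" if "p \<in> strip T" for n p
  proof -
    show "B > 0" using C Z l by (auto simp: B_def intro!: add_nonneg_pos)
    obtain x t where p: "p = (x, t)" "0 \<le> t" "t \<le> T"
      using \<open>p \<in> strip T\<close> by (cases p) auto
    have "Z / l * exp (l * t) \<le> Z / l * exp (l * T)"
      using p l Z by (intro mult_left_mono) (auto intro: mult_left_mono)
    with tx_bd[OF bd p(2,3), of n x] show "\<bar>sol_tx (src_x n) p\<bar> \<le> B"
      by (simp add: B_def p(1))
  qed
  have B0: "B > 0" using B(1)[of "(0, 0)"] T by auto
  have "uniform_limit (strip T) P (\<lambda>p. F1 (sol G p) (sol_t G p) * sol_x G p) sequentially"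
    unfolding P_def[abs_def]
  proof (intro uniform_lim_mult coefficient_uniform_limit[OF G contF1] sol_uniform_limit G)
    show "bounded ((\<lambda>p. F1 (sol G p) (sol_t G p)) ` strip T)"
      by (rule uniform_limit_bounded[OF coefficient_uniform_limit[OF G contF1]])
         (auto simp: bounded_iff intro!: always_eventually exI[of _ K] coeff)
    show "bounded (sol_x G ` strip T)"
      by (rule uniform_limit_bounded[OF sol_uniform_limit(3)[OF G]])
         (auto simp: bounded_iff intro!: always_eventually exI[of _ W] W)
  qed
  then have Pc: "uniformly_Cauchy_on (strip T) P"
    by (intro uniformly_convergent_Cauchy uniformly_convergentI)
  have Qc: "uniformly_Cauchy_on (strip T) Q"
    unfolding Q_def[abs_def]
    by (intro uniformly_convergent_Cauchy uniformly_convergentI[OF coefficient_uniform_limit[OF G contF2]])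
  show ?thesis
  proof (rule uniformly_convergent_almost_contraction[OF _ bd])
    fix e :: real assume e: "e > 0"
    then have "e / 2 > 0" "e / (2 * B) > 0" using B0 by auto
    then obtain N1 N2 where
      N1: "\<And>p m n. p \<in> strip T \<Longrightarrow> m \<ge> N1 \<Longrightarrow> n \<ge> N1 \<Longrightarrow> dist (P m p) (P n p) < e / 2" and
      N2: "\<And>p m n. p \<in> strip T \<Longrightarrow> m \<ge> N2 \<Longrightarrow> n \<ge> N2 \<Longrightarrow> dist (Q m p) (Q n p) < e / (2 * B)"
      using Pc Qc unfolding uniformly_Cauchy_on_def by meson
    have "exp_bounded T l (c / 2 + e) (\<lambda>p. src_x (Suc m) p - src_x (Suc n) p)"
      if mn: "m \<ge> max N1 N2" "n \<ge> max N1 N2" and c: "c \<ge> 0"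
        and b: "exp_bounded T l c (\<lambda>p. src_x m p - src_x n p)" for m n c
      unfolding exp_bounded_def
    proof (intro allI impI)
      fix x t :: real assume t: "0 \<le> t" "t \<le> T"
      let ?p = "(x, t)" and ?E = "exp (l * t)"
      have p: "?p \<in> strip T" using t by simp
      have E: "1 \<le> ?E" using l t by simp
      have cont: "continuous_on (strip T) (\<lambda>p. src_x m p - src_x n p)"
        by (intro continuous_intros src_continuous)
      have "\<bar>sol_tx (src_x m) ?p - sol_tx (src_x n) ?p\<bar> \<le> c / l * ?E"
        using duhamel_exp_bounded(1)[OF cont l(1) c b] t
          duhamel_diff(1)[OF src_continuous(2)[of m] src_continuous(2)[of n] p]
        by (simp add: sol_tx_def exp_bounded_def)
      then have "\<bar>Q n ?p\<bar> * \<bar>sol_tx (src_x m) ?p - sol_tx (src_x n) ?p\<bar> \<le> K * (c / l * ?E)"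
        by (intro mult_mono coeff p) (use K0 in auto)
      also have "\<dots> = (4 * K) * (c / l / 4 * ?E)" by simp
      also have "\<dots> \<le> l * (c / l / 4 * ?E)" using l c by (intro mult_right_mono) auto
      also have "\<dots> \<le> c / 2 * ?E" using l c by simp
      finally have t3: "\<bar>Q n ?p * (sol_tx (src_x m) ?p - sol_tx (src_x n) ?p)\<bar> \<le> c / 2 * ?E"
        by (simp add: abs_mult)
      have "\<bar>Q m ?p - Q n ?p\<bar> * \<bar>sol_tx (src_x m) ?p\<bar> \<le> e / (2 * B) * B"
        using N2[OF p, of m n] mn B[OF p] e B0 by (intro mult_mono) (auto simp: dist_real_def)
      then have t2: "\<bar>(Q m ?p - Q n ?p) * sol_tx (src_x m) ?p\<bar> \<le> e / 2"
        using B0 by (simp add: abs_mult)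
      have t1: "\<bar>P m ?p - P n ?p\<bar> \<le> e / 2"
        using N1[OF p, of m n] mn by (simp add: dist_real_def)
      have "src_x (Suc m) ?p - src_x (Suc n) ?p = (P m ?p - P n ?p) +
          (Q m ?p - Q n ?p) * sol_tx (src_x m) ?p + Q n ?p * (sol_tx (src_x m) ?p - sol_tx (src_x n) ?p)"
        unfolding next_eq by (simp add: algebra_simps)
      then have "\<bar>src_x (Suc m) ?p - src_x (Suc n) ?p\<bar> \<le> e / 2 + e / 2 + c / 2 * ?E"
        using t1 t2 t3 by linarith
      also have "\<dots> \<le> (c / 2 + e) * ?E"
        using mult_left_mono[OF E, of e] e by (simp add: algebra_simps)
      finally show "\<bar>src_x (Suc m) ?p - src_x (Suc n) ?p\<bar> \<le> (c / 2 + e) * ?E" .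
    qed
    then show "\<exists>N. \<forall>m\<ge>N. \<forall>n\<ge>N. \<forall>c\<ge>0. exp_bounded T l c (\<lambda>p. src_x m p - src_x n p) \<longrightarrow>
        exp_bounded T l (c / 2 + e) (\<lambda>p. src_x (Suc m) p - src_x (Suc n) p)" by blast
  qed (use l in auto)
qed

lemma source_exists:
  obtains G H where "C1x T G H" "\<And>p. p \<in> strip T \<Longrightarrow> G p = F (sol G p) (sol_t G p)"
proof -
  obtain G H where G: "uniform_limit (strip T) src G sequentially"
    and H: "uniform_limit (strip T) src_x H sequentially"
    using src_uniformly_convergent src_x_uniformly_convergent
    by (auto simp: uniformly_convergent_on_def)
  have "G p = F (sol G p) (sol_t G p)" if p: "p \<in> strip T" for p
  proof (rule LIMSEQ_unique)
    show "(\<lambda>n. src (Suc n) p) \<longlonglongrightarrow> G p"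
      using tendsto_uniform_limitI[OF G p] by (rule LIMSEQ_Suc)
    show "(\<lambda>n. src (Suc n) p) \<longlonglongrightarrow> F (sol G p) (sol_t G p)"
      using tendsto_uniform_limitI[OF coefficient_uniform_limit[OF G contF] p]
      by (simp add: step_def)
  qed
  then show thesis
    using uniform_limit_C1x[OF src_C1x G H] that by blast
qed

end

section \<open>From the source to a classical solution\<close>

lemma dt_cong:
  assumes "\<And>s. s \<in> {0..T} \<Longrightarrow> u x s = v x s" "t \<in> {0..T}"
  shows "dt T u x t = dt T v x t"
    "(\<lambda>s. u x s) differentiable (at t within {0..T}) \<longleftrightarrow> (\<lambda>s. v x s) differentiable (at t within {0..T})"
proof -
  have "((\<lambda>s. u x s) has_vector_derivative d) (at t within {0..T}) \<longleftrightarrow>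
      ((\<lambda>s. v x s) has_vector_derivative d) (at t within {0..T})" for d
    using has_vector_derivative_transform[OF assms(2), of "u x" "v x" d]
      has_vector_derivative_transform[OF assms(2), of "v x" "u x" d] assms(1) by auto
  then have eq: "(\<lambda>d. ((\<lambda>s. u x s) has_vector_derivative d) (at t within {0..T})) =
      (\<lambda>d. ((\<lambda>s. v x s) has_vector_derivative d) (at t within {0..T}))" by blast
  show 1: "dt T u x t = dt T v x t"
    unfolding dt_def vector_derivative_def eq ..
  show "(\<lambda>s. u x s) differentiable (at t within {0..T}) \<longleftrightarrow> (\<lambda>s. v x s) differentiable (at t within {0..T})"
    unfolding vector_derivative_works fun_cong[OF eq] using 1 by (simp add: dt_def)
qed

text \<open>
  The derivative functions \<open>dx u\<close> and \<open>dt T u\<close> are known explicitly only on the strip; this lemma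
  allows replacing them there.
\<close>

lemma Ck_strip_cong:
  assumes "\<And>x t. t \<in> {0..T} \<Longrightarrow> u x t = v x t"
  shows "Ck_strip T k u \<longleftrightarrow> Ck_strip T k v"
  using assms
proof (induction k arbitrary: u v)
  case 0
  then show ?case by (auto intro!: continuous_on_cong)
next
  case (Suc k)
  have "continuous_on (UNIV \<times> {0..T}) (\<lambda>(x, t). u x t) \<longleftrightarrow> continuous_on (UNIV \<times> {0..T}) (\<lambda>(x, t). v x t)"
    by (rule continuous_on_cong) (use Suc.prems in auto)
  moreover have "Ck_strip T k (dx u) \<longleftrightarrow> Ck_strip T k (dx v)"
    by (rule Suc.IH) (simp add: dx_def Suc.prems)
  moreover have "Ck_strip T k (dt T u) \<longleftrightarrow> Ck_strip T k (dt T v)"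
    by (rule Suc.IH) (rule dt_cong(1), rule Suc.prems)
  moreover have "(\<lambda>y. u y t) differentiable (at x) \<longleftrightarrow> (\<lambda>y. v y t) differentiable (at x)"
    if "t \<in> {0..T}" for x t
    by (simp only: Suc.prems[OF that])
  moreover have "(\<lambda>s. u x s) differentiable (at t within {0..T}) \<longleftrightarrow>
      (\<lambda>s. v x s) differentiable (at t within {0..T})" if "t \<in> {0..T}" for x t
    using dt_cong(2)[of T u x v t] Suc.prems that by blast
  ultimately show ?case by simp
qed

lemma dt_eqI:
  assumes "((\<lambda>s. u x s) has_real_derivative d) (at t within {0..T})" "T > 0" "t \<in> {0..T}"
  shows "dt T u x t = d"
  unfolding dt_def
  by (rule vector_derivative_within_closed_interval)
     (use assms in \<open>auto simp: has_real_derivative_iff_has_vector_derivative\<close>)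

lemma Ck_strip_SucI:
  assumes T: "T > 0" and C: "C1x T G H"
    and D: "\<And>x t. t \<in> {0..T} \<Longrightarrow> ((\<lambda>s. G (x, s)) has_real_derivative K (x, t)) (at t within {0..T})"
    and k: "Ck_strip T k (\<lambda>x t. H (x, t))" "Ck_strip T k (\<lambda>x t. K (x, t))"
  shows "Ck_strip T (Suc k) (\<lambda>x t. G (x, t))"
proof -
  have x: "((\<lambda>y. G (y, t)) has_real_derivative H (x, t)) (at x)" if "t \<in> {0..T}" for x t
    using C that by (auto simp: C1x_def)
  have "Ck_strip T k (dx (\<lambda>x t. G (x, t))) \<longleftrightarrow> Ck_strip T k (\<lambda>x t. H (x, t))"
    by (rule Ck_strip_cong) (simp add: dx_def DERIV_imp_deriv[OF x])
  moreover have "Ck_strip T k (dt T (\<lambda>x t. G (x, t))) \<longleftrightarrow> Ck_strip T k (\<lambda>x t. K (x, t))"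
    by (rule Ck_strip_cong) (rule dt_eqI[OF D T]; simp)
  moreover have "continuous_on (UNIV \<times> {0..T}) (\<lambda>(x, t). G (x, t))"
    using C by (simp add: C1x_def strip_def)
  ultimately show ?thesis
    using k x D unfolding Ck_strip.simps real_differentiable_def by blast
qed

context semilinear_wave
begin

text \<open>
  In \<open>u\<^sub>t\<^sub>t - u\<^sub>x\<^sub>x\<close> the second derivatives of the free solution and the characteristic integrals of \<open>H\<close>
  cancel, which leaves the source.
\<close>

lemma classical_solution_exists:
  "\<exists>u. Ck_strip T 2 u \<and>
     (\<forall>x. \<forall>t\<in>{0..T}. dt T (dt T u) x t - dx (dx u) x t = F (u x t) (dt T u x t)) \<and>
     (\<forall>x. u x 0 = \<alpha> x + \<beta> x \<and> dt T u x 0 = \<alpha>1 x - \<beta>1 x)"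
proof -
  obtain G H where C: "C1x T G H" and G: "\<And>p. p \<in> strip T \<Longrightarrow> G p = F (sol G p) (sol_t G p)"
    by (rule source_exists) blast
  define u where "u x t = sol G (x, t)" for x t
  have GH: "continuous_on (strip T) G" "continuous_on (strip T) H"
    using C by (auto simp: C1x_def)
  have c0: "Ck_strip T 0 (\<lambda>x t. k (x, t))" if "continuous_on (strip T) k" for k
    using that by (simp add: strip_def)
  have x: "Ck_strip T (Suc 0) (\<lambda>x t. sol_x G (x, t))"
    by (rule Ck_strip_SucI[OF T sol_C1x(3)[OF C] sol_dt(3)[OF C]])
       (auto intro!: c0 sol_continuous GH simp del: Ck_strip.simps)
  have "continuous_on (strip T) (\<lambda>p. G p + sol_xx H p)"
    by (intro continuous_on_add sol_continuous GH)
  then have t: "Ck_strip T (Suc 0) (\<lambda>x t. sol_t G (x, t))"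
    by (intro Ck_strip_SucI[OF T sol_C1x(2)[OF C], where K = "\<lambda>p. G p + sol_xx H p"] sol_dt(2)[OF C]
        c0 sol_continuous GH)
  have "Ck_strip T (Suc (Suc 0)) u"
    unfolding u_def by (rule Ck_strip_SucI[OF T sol_C1x(1)[OF C] sol_dt(1)[OF C] x t])
  then have "Ck_strip T 2 u" by (simp only: numeral_2_eq_2)
  moreover have ut: "dt T u x t = sol_t G (x, t)" if "t \<in> {0..T}" for x t
    unfolding u_def by (rule dt_eqI[OF sol_dt(1)[OF C that] T that])
  moreover have "dt T (dt T u) x t = G (x, t) + sol_xx H (x, t)" if t: "t \<in> {0..T}" for x t
  proof -
    have "dt T (dt T u) x t = dt T (\<lambda>x t. sol_t G (x, t)) x t"
      by (rule dt_cong(1)) (use ut t in auto)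
    also have "\<dots> = G (x, t) + sol_xx H (x, t)"
      by (rule dt_eqI[OF sol_dt(2)[OF C t] T t])
    finally show ?thesis .
  qed
  moreover have "dx (dx u) x t = sol_xx H (x, t)" if t: "t \<in> {0..T}" for x t
  proof -
    have d: "((\<lambda>y. sol G (y, t)) has_real_derivative sol_x G (y, t)) (at y)"
      "((\<lambda>y. sol_x G (y, t)) has_real_derivative sol_xx H (y, t)) (at y)" for y
      using sol_C1x(1,3)[OF C] t by (auto simp: C1x_def)
    have "(\<lambda>y. dx u y t) = (\<lambda>y. sol_x G (y, t))"
      by (simp add: fun_eq_iff dx_def u_def DERIV_imp_deriv[OF d(1)])
    then show ?thesis
      unfolding dx_def[of "dx u"] by (simp add: DERIV_imp_deriv[OF d(2)])
  qed
  moreover have "G (x, t) = F (u x t) (dt T u x t)" if "t \<in> {0..T}" for x t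
    using G[of "(x, t)"] ut[OF that] that by (simp add: u_def)
  moreover have "u x 0 = \<alpha> x + \<beta> x" "dt T u x 0 = \<alpha>1 x - \<beta>1 x" for x
    using ut[of 0 x] T by (simp_all add: u_def sol_def sol_t_def)
  ultimately show ?thesis by (intro exI[of _ u]) auto
qed

end

section \<open>The power nonlinearity\<close>

lemma continuous_on_abs_powr_sgn:
  fixes s :: real
  assumes s: "s > 0"
  shows "continuous_on UNIV (\<lambda>x::real. \<bar>x\<bar> powr s * sgn x)"
proof -
  have "(\<lambda>x::real. \<bar>x\<bar> powr s * sgn x) = (\<lambda>x. max x 0 powr s - max (- x) 0 powr s)"
    by (auto simp: fun_eq_iff sgn_real_def max_def)
  moreover have "continuous_on UNIV (\<lambda>x::real. max x 0 powr s - max (- x) 0 powr s)"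
    by (intro continuous_on_diff continuous_on_powr' continuous_intros) (use s in auto)
  ultimately show ?thesis by (simp only:)
qed

lemma continuous_on_abs_powr:
  fixes s :: real
  assumes s: "s > 0"
  shows "continuous_on UNIV (\<lambda>x::real. \<bar>x\<bar> powr s)"
  by (intro continuous_on_powr' continuous_intros) (use s in auto)

lemma DERIV_abs_powr:
  fixes s x :: real
  assumes s: "s > 1"
  shows "((\<lambda>x. \<bar>x\<bar> powr s) has_real_derivative s * (\<bar>x\<bar> powr (s - 1) * sgn x)) (at x)"
proof -
  consider "x > 0" | "x < 0" | "x = 0" by linarith
  then show ?thesis
  proof cases
    assume x: "x > 0"
    have "((\<lambda>x. x powr s) has_real_derivative s * x powr (s - 1)) (at x)"
      using x by (rule has_real_derivative_powr)
    then show ?thesis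
      by (rule DERIV_cong[OF has_field_derivative_transform_within_open[of _ _ _ "{0<..}"]]) (use x in auto)
  next
    assume x: "x < 0"
    have "((\<lambda>x. (- x) powr s) has_real_derivative s * (- x) powr (s - 1) * (- 1)) (at x)"
      by (rule DERIV_chain2[OF has_real_derivative_powr]) (use x in \<open>auto intro!: derivative_eq_intros\<close>)
    then show ?thesis
      by (rule DERIV_cong[OF has_field_derivative_transform_within_open[of _ _ _ "{..<0}"]]) (use x in auto)
  next
    assume x: "x = 0"
    have "(\<lambda>h::real. \<bar>h\<bar> powr (s - 1) * sgn h) \<midarrow>0\<rightarrow> \<bar>0\<bar> powr (s - 1) * sgn 0"
      using continuous_on_abs_powr_sgn[of "s - 1"] s unfolding continuous_on_def
      by (metis UNIV_I diff_gt_0_iff_gt)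
    moreover have "\<bar>h\<bar> powr (s - 1) * sgn h = (\<bar>0 + h\<bar> powr s - \<bar>0::real\<bar> powr s) / h" if "h \<noteq> 0" for h :: real
      using that by (auto simp: sgn_real_def powr_diff)
    ultimately show ?thesis
      unfolding x DERIV_def by (simp cong: LIM_cong)
  qed
qed

lemma power_nonlinearity_chain:
  fixes p q r A B :: real and f g :: "real \<Rightarrow> real"
  assumes pqr: "p > 1" "q > 1" "r > 1"
    and f: "(f has_real_derivative f') (at x)" and g: "(g has_real_derivative g') (at x)"
  shows "((\<lambda>y. A * \<bar>g y\<bar> powr p * \<bar>f y\<bar> powr q + B * \<bar>f y\<bar> powr r) has_real_derivative
     (A * \<bar>g x\<bar> powr p * (q * (\<bar>f x\<bar> powr (q - 1) * sgn (f x)))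
        + B * (r * (\<bar>f x\<bar> powr (r - 1) * sgn (f x)))) * f'
     + A * (p * (\<bar>g x\<bar> powr (p - 1) * sgn (g x))) * \<bar>f x\<bar> powr q * g') (at x)"
  by (rule derivative_eq_intros DERIV_chain2[OF DERIV_abs_powr[OF pqr(1)] g]
      DERIV_chain2[OF DERIV_abs_powr[OF pqr(2)] f] DERIV_chain2[OF DERIV_abs_powr[OF pqr(3)] f] refl)+
     (simp add: algebra_simps)

lemma power_nonlinearity_mono:
  fixes p q r A B m n u v :: real
  assumes "p > 1" "q > 1" "r > 1" "A > 0" "B > 0" "\<bar>u\<bar> \<le> m" "\<bar>v\<bar> \<le> n"
  shows "\<bar>A * \<bar>v\<bar> powr p * \<bar>u\<bar> powr q + B * \<bar>u\<bar> powr r\<bar> \<le> A * n powr p * m powr q + B * m powr r"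
proof -
  have "A * \<bar>v\<bar> powr p * \<bar>u\<bar> powr q + B * \<bar>u\<bar> powr r \<le> A * n powr p * m powr q + B * m powr r"
    using assms by (intro add_mono mult_mono powr_mono2) auto
  moreover have "0 \<le> A * \<bar>v\<bar> powr p * \<bar>u\<bar> powr q + B * \<bar>u\<bar> powr r"
    using assms by auto
  ultimately show ?thesis by simp
qed

section \<open>Compactly supported travelling profiles\<close>

lemma bounded_range_compact_support:
  fixes k :: "real \<Rightarrow> real"
  assumes "continuous_on UNIV k" "\<And>y. R < \<bar>y\<bar> \<Longrightarrow> k y = 0"
  shows "\<exists>C\<ge>0. \<forall>y. \<bar>k y\<bar> \<le> C"
proof -
  have "bounded (k ` {-R..R})"
    by (intro compact_imp_bounded compact_continuous_image continuous_on_subset[OF assms(1)]) auto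
  then obtain C where C: "\<And>y. y \<in> {-R..R} \<Longrightarrow> \<bar>k y\<bar> \<le> C"
    unfolding bounded_iff by (auto simp del: atLeastAtMost_iff)
  have "\<bar>k y\<bar> \<le> \<bar>C\<bar>" for y
  proof (cases "R < \<bar>y\<bar>")
    case False
    then have "y \<in> {-R..R}" by auto
    from C[OF this] show ?thesis by linarith
  qed (simp add: assms(2))
  then show ?thesis by (intro exI[of _ "\<bar>C\<bar>"]) auto
qed

lemma vanishing_outside_support:
  assumes "topological_support k \<subseteq> {x. \<bar>x\<bar> \<le> R}" "R < \<bar>y\<bar>"
  shows "k y = 0"
proof (rule ccontr)
  assume "k y \<noteq> 0"
  then have "y \<in> topological_support k"
    unfolding topological_support_def by (intro subsetD[OF closure_subset]) simp
  with assms show False by auto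
qed

lemma deriv_vanishing:
  fixes k k' :: "real \<Rightarrow> real"
  assumes z: "\<And>y. R < \<bar>y\<bar> \<Longrightarrow> k y = 0" and d: "(k has_real_derivative k' y) (at y)" and y: "R < \<bar>y\<bar>"
  shows "k' y = 0"
proof -
  have "open {y. R < \<bar>y\<bar>}" by (intro open_Collect_less continuous_intros)
  then have "((\<lambda>_. 0) has_real_derivative k' y) (at y)"
    by (rule has_field_derivative_transform_within_open[OF d]) (simp_all add: y z)
  then show ?thesis using DERIV_const DERIV_unique by blast
qed

text \<open>
  This is where the mean of \<open>g\<close> enters: a primitive that vanishes to the left of the support is
  equal to the integral of \<open>g\<close> to the right of it.
\<close>

lemma compactly_supported_primitive:
  fixes g :: "real \<Rightarrow> real"
  assumes g: "continuous_on UNIV g" and z: "\<And>y. R < \<bar>y\<bar> \<Longrightarrow> g y = 0" and R: "R \<ge> 0"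
    and int: "(LINT x|lborel. g x) = 0"
  shows "\<exists>P. (\<forall>y. (P has_real_derivative g y) (at y)) \<and> (\<forall>y. R < \<bar>y\<bar> \<longrightarrow> P y = 0)"
proof -
  \<comment> \<open>Starting one unit to the left of the support leaves every point either in the region where
    everything vanishes or in the interior of an interval of integration.\<close>
  define P where "P y = integral {- R - 1..y} g" for y
  have c: "continuous_on S g" for S by (rule continuous_on_subset[OF g]) simp
  have left: "P y = 0" if "y < - R" for y
  proof -
    have "P y = integral {- R - 1..y} (\<lambda>_. 0)"
      unfolding P_def by (rule integral_cong) (use that R in \<open>auto intro!: z\<close>)
    then show ?thesis by simp
  qed
  have right: "P y = 0" if "R < y" for y
  proof -
    have "integrable lborel (\<lambda>x. indicator {-R..R} x *\<^sub>R g x)"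
      using borel_integrable_atLeastAtMost'[OF c] by (simp add: set_integrable_def)
    also have "(\<lambda>x. indicator {-R..R} x *\<^sub>R g x) = g"
      using z by (force simp: fun_eq_iff indicator_def)
    finally have "(g has_integral 0) UNIV"
      using has_integral_integral_lborel[of g] int by simp
    moreover have "(\<lambda>x. if x \<in> {- R - 1..y} then g x else 0) = g"
      using z that R by (force simp: fun_eq_iff)
    ultimately have "(g has_integral 0) {- R - 1..y}"
      using has_integral_restrict_UNIV[of "{- R - 1..y}" g 0] by simp
    then show ?thesis by (simp add: P_def integral_unique)
  qed
  have "(P has_real_derivative g y) (at y)" for y
  proof (cases "y < - R")
    case True
    have "((\<lambda>_. 0) has_real_derivative 0) (at y)" by simp
    then have "(P has_real_derivative 0) (at y)"
      by (rule has_field_derivative_transform_within_open[of _ _ _ "{..<- R}"]) (use True left in auto)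
    then show ?thesis using z[of y] True R by simp
  next
    case False
    have "(P has_real_derivative g y) (at y within {- R - 1..y + 1})"
      unfolding P_def using False by (intro integral_has_real_derivative c) auto
    moreover have "at y within {- R - 1..y + 1} = at y"
      by (rule at_within_interior) (use False in auto)
    ultimately show ?thesis by simp
  qed
  moreover have "P y = 0" if "R < \<bar>y\<bar>" for y
    using left right that by (cases "y < 0") auto
  ultimately show ?thesis by blast
qed

section \<open>Choice of the constants\<close>

text \<open>
  The three regimes share one description. With \<open>m = min (p + q) r\<close> the exponent \<open>\<theta>\<close> of the applicable
  regime is the smaller of \<open>m - 1\<close> and \<open>m (r - 1) / (r + 1)\<close>: the first bound keeps the perturbation
  below the data, the second keeps the self-interaction of the perturbation inside the cone under
  control.
\<close>

lemma lifespan_exponent: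
  fixes p q r :: real
  assumes "p > 1" "q > 1" "r > 1"
  defines "m \<equiv> min (p + q) r"
  obtains \<theta> where "\<theta> > 0" "\<theta> \<le> m - 1" "\<theta> * (r + 1) \<le> m * (r - 1)"
    "\<And>c \<epsilon> T. (p + q \<le> (r + 1) / 2 \<longrightarrow> T \<le> c * \<epsilon> powr (- (p + q - 1))) \<Longrightarrow>
       ((r + 1) / 2 \<le> p + q \<and> p + q \<le> r \<longrightarrow> T \<le> c * \<epsilon> powr (- ((p + q) * (r - 1) / (r + 1)))) \<Longrightarrow>
       (p + q \<ge> r \<longrightarrow> T \<le> c * \<epsilon> powr (- (r * (r - 1) / (r + 1)))) \<Longrightarrow> T \<le> c * \<epsilon> powr (- \<theta>)"
proof -
  consider "p + q \<le> (r + 1) / 2" | "(r + 1) / 2 \<le> p + q" "p + q \<le> r" | "p + q \<ge> r" by linarith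
  then show thesis
  proof cases
    case 1
    then have m: "m = p + q" using assms by (simp add: m_def)
    show thesis
      by (rule that[of "p + q - 1"]) (use 1 assms m in \<open>auto simp: algebra_simps\<close>)
  next
    case 2
    then have m: "m = p + q" by (simp add: m_def)
    have "m * (r - 1) / (r + 1) \<le> m - 1"
      using 2 assms m by (simp add: pos_divide_le_eq) (simp add: algebra_simps)
    then show thesis
      by (intro that[of "m * (r - 1) / (r + 1)"]) (use 2 assms m in auto)
  next
    case 3
    then have m: "m = r" by (simp add: m_def)
    have "r * (r - 1) / (r + 1) \<le> r - 1"
      using assms by (simp add: pos_divide_le_eq)
    then show thesis
      by (intro that[of "r * (r - 1) / (r + 1)"]) (use 3 assms m in auto)
  qed
qed

lemma time_smallness:
  fixes p q r \<kappa> :: real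
  assumes pqr: "p > 1" "q > 1" "r > 1" and \<kappa>: "\<kappa> > 0"
  defines "m \<equiv> min (p + q) r"
  shows "\<exists>\<epsilon>2>0. \<exists>c>0. \<forall>\<epsilon>. 0 < \<epsilon> \<and> \<epsilon> \<le> \<epsilon>2 \<longrightarrow> (\<forall>T>0.
       (p + q \<le> (r + 1) / 2 \<longrightarrow> T \<le> c * \<epsilon> powr (- (p + q - 1))) \<and>
       ((r + 1) / 2 \<le> p + q \<and> p + q \<le> r \<longrightarrow> T \<le> c * \<epsilon> powr (- ((p + q) * (r - 1) / (r + 1)))) \<and>
       (p + q \<ge> r \<longrightarrow> T \<le> c * \<epsilon> powr (- (r * (r - 1) / (r + 1)))) \<longrightarrow>
       (T + 1) * \<epsilon> powr (m - 1) \<le> \<kappa> \<and> (T + 1) powr (r + 1) * \<epsilon> powr (m * (r - 1)) \<le> \<kappa>)"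
proof -
  obtain \<theta> where \<theta>: "\<theta> > 0" "\<theta> \<le> m - 1" "\<theta> * (r + 1) \<le> m * (r - 1)"
    and bound: "\<And>c \<epsilon> T. (p + q \<le> (r + 1) / 2 \<longrightarrow> T \<le> c * \<epsilon> powr (- (p + q - 1))) \<Longrightarrow>
       ((r + 1) / 2 \<le> p + q \<and> p + q \<le> r \<longrightarrow> T \<le> c * \<epsilon> powr (- ((p + q) * (r - 1) / (r + 1)))) \<Longrightarrow>
       (p + q \<ge> r \<longrightarrow> T \<le> c * \<epsilon> powr (- (r * (r - 1) / (r + 1)))) \<Longrightarrow> T \<le> c * \<epsilon> powr (- \<theta>)"
    using lifespan_exponent[OF pqr] unfolding m_def by metis
  \<comment> \<open>One half of \<open>\<kappa>\<close> is for \<open>T\<close>, the other for the additional unit of time.\<close>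
  define c where "c = min \<kappa> 1 / 2"
  have c: "c > 0" "2 * c \<le> \<kappa>" "2 * c \<le> 1" using \<kappa> by (auto simp: c_def)
  define e where "e = min 1 (c powr (1 / \<theta>))"
  have e: "e > 0" using c by (simp add: e_def)
  have *: "(T + 1) * \<epsilon> powr (m - 1) \<le> \<kappa> \<and> (T + 1) powr (r + 1) * \<epsilon> powr (m * (r - 1)) \<le> \<kappa>"
    if \<epsilon>: "0 < \<epsilon>" "\<epsilon> \<le> e" and T: "T > 0" "T \<le> c * \<epsilon> powr (- \<theta>)" for \<epsilon> T
  proof -
    have \<epsilon>1: "\<epsilon> \<le> 1" using \<epsilon> by (simp add: e_def)
    have "\<epsilon> powr \<theta> \<le> (c powr (1 / \<theta>)) powr \<theta>"
      using \<epsilon> \<theta> by (intro powr_mono2) (auto simp: e_def)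
    also have "\<dots> = c" using c \<theta> by (simp add: powr_powr)
    finally have "1 \<le> c * \<epsilon> powr (- \<theta>)"
      using \<epsilon> by (simp add: powr_minus field_simps)
    then have T1: "T + 1 \<le> 2 * c * \<epsilon> powr (- \<theta>)" using T by simp
    have "(T + 1) * \<epsilon> powr (m - 1) \<le> 2 * c * \<epsilon> powr (- \<theta>) * \<epsilon> powr (m - 1)"
      using T1 by (intro mult_right_mono) auto
    also have "\<dots> = 2 * c * \<epsilon> powr (m - 1 - \<theta>)"
      by (simp add: powr_add[symmetric])
    also have "\<dots> \<le> 2 * c * 1"
      using c \<epsilon> \<epsilon>1 \<theta> by (intro mult_left_mono powr_le1) auto
    finally have 1: "(T + 1) * \<epsilon> powr (m - 1) \<le> \<kappa>" using c by simp
    have "(T + 1) powr (r + 1) * \<epsilon> powr (m * (r - 1))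
        \<le> (2 * c * \<epsilon> powr (- \<theta>)) powr (r + 1) * \<epsilon> powr (m * (r - 1))"
      using T1 T pqr by (intro mult_right_mono powr_mono2) auto
    also have "\<dots> = (2 * c) powr (r + 1) * \<epsilon> powr (m * (r - 1) - \<theta> * (r + 1))"
      using c by (simp add: powr_mult powr_powr powr_add[symmetric] algebra_simps)
    also have "\<dots> \<le> (2 * c) powr 1 * 1"
      using c \<epsilon> \<epsilon>1 \<theta> pqr by (intro mult_mono powr_mono' powr_le1) auto
    finally have 2: "(T + 1) powr (r + 1) * \<epsilon> powr (m * (r - 1)) \<le> \<kappa>" using c by simp
    from 1 2 show ?thesis ..
  qed
  show ?thesis
    by (rule exI[of _ e], rule conjI[OF e], rule exI[of _ c], rule conjI[OF c(1)],
        intro allI impI, rule *) (auto intro: bound)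
qed

text \<open>
  The source near the cone has size \<open>a\<close>, which is of order \<open>\<epsilon> powr m\<close>, and makes a perturbation of
  order \<open>a T\<close> inside the cone. This fixes \<open>M = 6 R a T\<close>, twice what the source near the cone
  contributes; its time derivative has order \<open>N = M / T\<close>. It remains that the source inside the cone
  contributes at most \<open>M / 2\<close>. For \<open>B |u|\<^sup>r\<close> this is \<open>B M\<^sup>r T\<^sup>2 \<le> M / 4\<close>, the condition on \<open>T powr (r + 1)\<close>.
  For \<open>A |u\<^sub>t|\<^sup>p |u|\<^sup>q\<close> it follows from \<open>M \<le> C \<epsilon>\<close> and the smallness of \<open>T \<epsilon> powr (m - 1)\<close>, since \<open>N\<close> is
  smaller than \<open>M\<close> by the factor \<open>T\<close>.
\<close>

lemma bootstrap_constants: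
  fixes p q r A B R C :: real
  assumes pqr: "p > 1" "q > 1" "r > 1" and AB: "A > 0" "B > 0" and R: "R \<ge> 1" and C: "C > 0"
  defines "m \<equiv> min (p + q) r"
  shows "\<exists>\<kappa>>0. \<forall>\<epsilon> T. 0 < \<epsilon> \<longrightarrow> \<epsilon> \<le> 1 \<longrightarrow> 2 * C * \<epsilon> \<le> 1 \<longrightarrow> T \<ge> 1 \<longrightarrow>
     T * \<epsilon> powr (m - 1) \<le> \<kappa> \<longrightarrow> T powr (r + 1) * \<epsilon> powr (m * (r - 1)) \<le> \<kappa> \<longrightarrow>
     (\<exists>a b M N.
       a = A * (2 * (C * \<epsilon>)) powr p * (2 * (C * \<epsilon>)) powr q + B * (2 * (C * \<epsilon>)) powr r \<and>
       b = A * N powr p * M powr q + B * M powr r \<and>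
       3 * R * a * T + b * T\<^sup>2 \<le> M \<and> R * a + T * b \<le> N \<and> a * T \<le> M \<and> M \<le> C * \<epsilon> \<and> N \<le> 1)"
proof -
  define K where "K = A * (2 * C) powr (p + q) + B * (2 * C) powr r"
  have K: "K > 0" using AB C by (simp add: K_def add_pos_pos)
  define L where "L = 6 * R * K"
  have L: "L > 0" using K R by (simp add: L_def)
  define \<kappa> where "\<kappa> = min (C / L) (min (1 / (4 * B * L powr (r - 1))) (1 / (4 * A * C powr (p + q - 1))))"
  have \<kappa>: "\<kappa> > 0" using L C AB by (simp add: \<kappa>_def)
  have k1: "L * \<kappa> \<le> C" using L by (simp add: \<kappa>_def min_def field_simps)
  have k2: "B * L powr (r - 1) * \<kappa> \<le> 1 / 4"
  proof -
    have "B * L powr (r - 1) * \<kappa> \<le> B * L powr (r - 1) * (1 / (4 * B * L powr (r - 1)))"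
      using AB by (intro mult_left_mono) (auto simp: \<kappa>_def)
    then show ?thesis using AB L by simp
  qed
  have k3: "A * C powr (p + q - 1) * \<kappa> \<le> 1 / 4"
  proof -
    have "A * C powr (p + q - 1) * \<kappa> \<le> A * C powr (p + q - 1) * (1 / (4 * A * C powr (p + q - 1)))"
      using AB by (intro mult_left_mono) (auto simp: \<kappa>_def)
    then show ?thesis using AB C by simp
  qed
  have main: "\<exists>a b M N.
       a = A * (2 * (C * \<epsilon>)) powr p * (2 * (C * \<epsilon>)) powr q + B * (2 * (C * \<epsilon>)) powr r \<and>
       b = A * N powr p * M powr q + B * M powr r \<and>
       3 * R * a * T + b * T\<^sup>2 \<le> M \<and> R * a + T * b \<le> N \<and> a * T \<le> M \<and> M \<le> C * \<epsilon> \<and> N \<le> 1"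
    if \<epsilon>: "0 < \<epsilon>" "\<epsilon> \<le> 1" "2 * C * \<epsilon> \<le> 1" and T: "T \<ge> 1"
      and s1: "T * \<epsilon> powr (m - 1) \<le> \<kappa>" and s2: "T powr (r + 1) * \<epsilon> powr (m * (r - 1)) \<le> \<kappa>" for \<epsilon> T
  proof -
    define a where "a = A * (2 * (C * \<epsilon>)) powr p * (2 * (C * \<epsilon>)) powr q + B * (2 * (C * \<epsilon>)) powr r"
    define M where "M = 6 * R * a * T"
    define N where "N = M / T"
    define b where "b = A * N powr p * M powr q + B * M powr r"
    have a: "a > 0" using AB C \<epsilon> by (simp add: a_def add_pos_pos)
    have M: "M > 0" using a R T by (simp add: M_def)
    have N: "N > 0" "N \<le> M" "N * T = M" using M T by (auto simp: N_def field_simps)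
    have em: "\<epsilon> powr (p + q) \<le> \<epsilon> powr m" "\<epsilon> powr r \<le> \<epsilon> powr m"
      using \<epsilon> by (auto simp: m_def intro!: powr_mono')
    have "a = A * (2 * C) powr (p + q) * \<epsilon> powr (p + q) + B * (2 * C) powr r * \<epsilon> powr r"
    proof -
      have "(2 * (C * \<epsilon>)) powr p * (2 * (C * \<epsilon>)) powr q = ((2 * C) * \<epsilon>) powr (p + q)"
        by (simp add: powr_add mult.assoc)
      then show ?thesis
        using C \<epsilon> by (simp add: a_def powr_mult mult.assoc)
    qed
    also have "\<dots> \<le> A * (2 * C) powr (p + q) * \<epsilon> powr m + B * (2 * C) powr r * \<epsilon> powr m"
      using em AB by (intro add_mono mult_left_mono) auto
    also have "\<dots> = K * \<epsilon> powr m" by (simp add: K_def algebra_simps)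
    finally have "a \<le> K * \<epsilon> powr m" .
    then have "6 * R * T * a \<le> 6 * R * T * (K * \<epsilon> powr m)"
      using R T by (intro mult_left_mono) auto
    then have M_le: "M \<le> L * (T * \<epsilon> powr m)" by (simp add: M_def L_def mult_ac)
    have "\<epsilon> powr m = \<epsilon> powr (m - 1) * \<epsilon>"
      using \<epsilon> by (simp add: powr_diff)
    then have "L * (T * \<epsilon> powr m) = L * (T * \<epsilon> powr (m - 1)) * \<epsilon>" by simp
    also have "\<dots> \<le> L * \<kappa> * \<epsilon>"
      using s1 L \<epsilon> by (intro mult_right_mono mult_left_mono) auto
    also have "\<dots> \<le> C * \<epsilon>" using k1 \<epsilon> by (intro mult_right_mono) auto
    finally have MC: "M \<le> C * \<epsilon>" using M_le by simp
    have b2: "B * M powr r * T\<^sup>2 \<le> M / 4"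
    proof -
      have "M powr (r - 1) * T\<^sup>2 \<le> (L * (T * \<epsilon> powr m)) powr (r - 1) * T\<^sup>2"
        using M_le M pqr by (intro mult_right_mono powr_mono2) auto
      also have "\<dots> = L powr (r - 1) * (T powr (r - 1) * T powr 2 * \<epsilon> powr (m * (r - 1)))"
        using L T by (simp add: powr_mult powr_powr powr_numeral)
      also have "T powr (r - 1) * T powr 2 = T powr (r + 1)"
        by (simp add: powr_add[symmetric] add.commute)
      also have "L powr (r - 1) * (T powr (r + 1) * \<epsilon> powr (m * (r - 1))) \<le> L powr (r - 1) * \<kappa>"
        by (rule mult_left_mono[OF s2]) simp
      finally have "B * M * (M powr (r - 1) * T\<^sup>2) \<le> B * M * (L powr (r - 1) * \<kappa>)"
        using AB M by (intro mult_left_mono) auto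
      also have "\<dots> = M * (B * L powr (r - 1) * \<kappa>)" by simp
      also have "\<dots> \<le> M * (1 / 4)" using k2 M by (intro mult_left_mono) auto
      finally have "B * (M * M powr (r - 1)) * T\<^sup>2 \<le> M / 4" by (simp add: mult_ac)
      also have "M * M powr (r - 1) = M powr r" using M by (simp add: powr_diff)
      finally show ?thesis .
    qed
    have b1: "A * N powr p * M powr q * T\<^sup>2 \<le> M / 4"
    proof -
      have "N powr p * T\<^sup>2 = N * N powr (p - 1) * T\<^sup>2" using N by (simp add: powr_diff)
      also have "\<dots> = M * N powr (p - 1) * T"
        using N(3) by (simp add: power2_eq_square mult_ac)
      also have "\<dots> \<le> M * M powr (p - 1) * T"
        using M N T pqr by (intro mult_right_mono mult_left_mono powr_mono2) auto
      finally have "A * M powr q * (N powr p * T\<^sup>2) \<le> A * M powr q * (M * M powr (p - 1) * T)"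
        using AB by (intro mult_left_mono) auto
      also have "\<dots> = A * M * (M powr (p + q - 1) * T)"
      proof -
        have "M powr q * M powr (p - 1) = M powr (p + q - 1)"
          by (simp add: powr_add[symmetric] algebra_simps)
        then show ?thesis by (simp add: mult_ac)
      qed
      also have "\<dots> \<le> A * M * ((C * \<epsilon>) powr (p + q - 1) * T)"
        using MC M T AB pqr by (intro mult_left_mono mult_right_mono powr_mono2) auto
      also have "\<dots> = M * (A * C powr (p + q - 1) * (T * \<epsilon> powr (p + q - 1)))"
        using C \<epsilon> by (simp add: powr_mult)
      also have "\<dots> \<le> M * (A * C powr (p + q - 1) * (T * \<epsilon> powr (m - 1)))"
        using M AB T \<epsilon> by (intro mult_left_mono powr_mono') (auto simp: m_def)
      also have "\<dots> \<le> M * (A * C powr (p + q - 1) * \<kappa>)"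
        using M AB s1 by (intro mult_left_mono) auto
      also have "\<dots> \<le> M * (1 / 4)" using k3 M by (intro mult_left_mono) auto
      finally show ?thesis by (simp add: mult_ac)
    qed
    have bT: "b * T\<^sup>2 \<le> M / 2" using b1 b2 by (simp add: b_def algebra_simps)
    have i1: "3 * R * a * T + b * T\<^sup>2 \<le> M" using bT by (simp add: M_def)
    have i2: "R * a + T * b \<le> N"
    proof -
      have "0 \<le> R * a * T" using R a T by simp
      then have "(R * a + T * b) * T \<le> N * T"
        using i1 N(3) by (simp add: power2_eq_square algebra_simps)
      then show ?thesis using T by simp
    qed
    have i3: "a * T \<le> M"
    proof -
      have "1 * (a * T) \<le> (6 * R) * (a * T)" using R a T by (intro mult_right_mono) auto
      then show ?thesis by (simp add: M_def mult_ac)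
    qed
    have "N \<le> 1" using N MC \<epsilon> C by simp
    show ?thesis
      by (rule exI[of _ a], rule exI[of _ b], rule exI[of _ M], rule exI[of _ N])
         (intro conjI a_def b_def i1 i2 i3 MC \<open>N \<le> 1\<close>)
  qed
  then show ?thesis using \<kappa> by blast
qed

section \<open>Existence up to the lifespan\<close>

lemma power_nonlinearity_continuous:
  fixes p q r A B :: real
  assumes pqr: "p > 1" "q > 1" "r > 1"
  shows "continuous_on UNIV (\<lambda>(u, v). A * \<bar>v\<bar> powr p * \<bar>u\<bar> powr q + B * \<bar>u\<bar> powr r)"
    "continuous_on UNIV (\<lambda>(u, v). A * \<bar>v\<bar> powr p * (q * (\<bar>u\<bar> powr (q - 1) * sgn u))
        + B * (r * (\<bar>u\<bar> powr (r - 1) * sgn u)))"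
    "continuous_on UNIV (\<lambda>(u, v). A * (p * (\<bar>v\<bar> powr (p - 1) * sgn v)) * \<bar>u\<bar> powr q)"
proof -
  have fs: "continuous_on UNIV (\<lambda>w::real \<times> real. k (fst w))" "continuous_on UNIV (\<lambda>w::real \<times> real. k (snd w))"
    if "continuous_on UNIV k" for k :: "real \<Rightarrow> real"
    by (rule continuous_on_compose2[OF that]; auto intro: continuous_intros)+
  have c: "continuous_on UNIV (\<lambda>x::real. \<bar>x\<bar> powr s)"
    "continuous_on UNIV (\<lambda>x::real. \<bar>x\<bar> powr (s - 1) * sgn x)" if "s > 1" for s
    using continuous_on_abs_powr[of s] continuous_on_abs_powr_sgn[of "s - 1"] that by simp_all
  show "continuous_on UNIV (\<lambda>(u, v). A * \<bar>v\<bar> powr p * \<bar>u\<bar> powr q + B * \<bar>u\<bar> powr r)"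
    unfolding case_prod_beta
    by (intro continuous_on_add continuous_on_mult continuous_on_const fs c pqr)
  show "continuous_on UNIV (\<lambda>(u, v). A * \<bar>v\<bar> powr p * (q * (\<bar>u\<bar> powr (q - 1) * sgn u))
        + B * (r * (\<bar>u\<bar> powr (r - 1) * sgn u)))"
    unfolding case_prod_beta
    by (intro continuous_on_add continuous_on_mult[of UNIV "\<lambda>_. _"]
        continuous_on_mult[of UNIV "\<lambda>w. A * \<bar>snd w\<bar> powr p"] continuous_on_const fs(2)[OF c(1)] fs(1)[OF c(2)] pqr)
  show "continuous_on UNIV (\<lambda>(u, v). A * (p * (\<bar>v\<bar> powr (p - 1) * sgn v)) * \<bar>u\<bar> powr q)"
    unfolding case_prod_beta
    by (intro continuous_on_mult[of UNIV _ "\<lambda>w. \<bar>fst w\<bar> powr q"] continuous_on_mult[of UNIV "\<lambda>_. _"]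
        continuous_on_const fs(1)[OF c(1)] fs(2)[OF c(2)] pqr)
qed

theorem theorem2p2:
  fixes p q r A B R :: real and f g :: "real \<Rightarrow> real"
  assumes "p > 1" and "q > 1" and "r > 1"
    and "A > 0" and "B > 0" and "R \<ge> 1"
    and "Ck_real_compact 2 f" and "Ck_real_compact 1 g"
    and "topological_support f \<subseteq> {x. \<bar>x\<bar> \<le> R}"
    and "topological_support g \<subseteq> {x. \<bar>x\<bar> \<le> R}"
    and "(LINT x|lborel. g x) = 0"
  shows "\<exists>\<epsilon>\<^sub>2>0. \<exists>c>0. \<forall>\<epsilon>. 0 < \<epsilon> \<and> \<epsilon> \<le> \<epsilon>\<^sub>2 \<longrightarrow>
    (\<forall>T>0.
       (p + q \<le> (r + 1) / 2 \<longrightarrow> T \<le> c * \<epsilon> powr (- (p + q - 1))) \<and>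
       ((r + 1) / 2 \<le> p + q \<and> p + q \<le> r \<longrightarrow>
          T \<le> c * \<epsilon> powr (- ((p + q) * (r - 1) / (r + 1)))) \<and>
       (p + q \<ge> r \<longrightarrow> T \<le> c * \<epsilon> powr (- (r * (r - 1) / (r + 1))))
       \<longrightarrow> (\<exists>u. classical_solution A B p q r
                  (\<lambda>x. \<epsilon> * f x) (\<lambda>x. \<epsilon> * g x) T u))"
proof -
  note pqr = assms(1-3) and AB = assms(4,5)
  have R0: "R \<ge> 0" and R1: "R + 1 \<ge> 1" using assms(6) by auto
  define f1 f2 g1 where "f1 = deriv f" and "f2 = deriv (deriv f)" and "g1 = deriv g"
  have f: "\<And>y. (f has_real_derivative f1 y) (at y)" "\<And>y. (f1 has_real_derivative f2 y) (at y)"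
    "continuous_on UNIV f2"
    using assms(7)
    by (auto simp: Ck_real_compact_def Ck_real_def f1_def f2_def numeral_2_eq_2 less_Suc_eq le_Suc_eq
        all_conj_distrib DERIV_deriv_iff_real_differentiable)
  have g: "\<And>y. (g has_real_derivative g1 y) (at y)" "continuous_on UNIV g1"
    using assms(8)
    by (auto simp: Ck_real_compact_def Ck_real_def g1_def le_Suc_eq
        all_conj_distrib DERIV_deriv_iff_real_differentiable)
  have cont: "continuous_on UNIV f" "continuous_on UNIV f1" "continuous_on UNIV g"
    using f(1,2) g(1) by (auto intro: DERIV_continuous_on)
  have fz: "f y = 0" and gz: "g y = 0" if "R < \<bar>y\<bar>" for y
    using vanishing_outside_support[OF assms(9) that] vanishing_outside_support[OF assms(10) that] .
  have f1z: "f1 y = 0" if "R < \<bar>y\<bar>" for y by (rule deriv_vanishing[of R f f1, OF fz f(1) that])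
  have f2z: "f2 y = 0" if "R < \<bar>y\<bar>" for y by (rule deriv_vanishing[of R f1 f2, OF f1z f(2) that])
  have g1z: "g1 y = 0" if "R < \<bar>y\<bar>" for y by (rule deriv_vanishing[of R g g1, OF gz g(1) that])
  obtain P where P: "\<And>y. (P has_real_derivative g y) (at y)" and Pz: "\<And>y. R < \<bar>y\<bar> \<Longrightarrow> P y = 0"
    using compactly_supported_primitive[OF cont(3) gz R0 assms(11)] by blast
  have contP: "continuous_on UNIV P" using P by (auto intro: DERIV_continuous_on)
  obtain Cf Cf1 Cg CP Cf2 Cg1 where
    C: "\<And>y. \<bar>f y\<bar> \<le> Cf" "\<And>y. \<bar>f1 y\<bar> \<le> Cf1" "\<And>y. \<bar>g y\<bar> \<le> Cg" "\<And>y. \<bar>P y\<bar> \<le> CP"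
       "\<And>y. \<bar>f2 y\<bar> \<le> Cf2" "\<And>y. \<bar>g1 y\<bar> \<le> Cg1"
      and C0: "0 \<le> Cf" "0 \<le> Cf1" "0 \<le> Cg" "0 \<le> CP"
    using bounded_range_compact_support[OF cont(1) fz] bounded_range_compact_support[OF cont(2) f1z]
      bounded_range_compact_support[OF cont(3) gz] bounded_range_compact_support[OF contP Pz]
      bounded_range_compact_support[OF f(3) f2z] bounded_range_compact_support[OF g(2) g1z]
    by metis
  define C where "C = Cf + Cf1 + Cg + CP + 1"
  have Cpos: "C > 0" using C0 by (simp add: C_def)
  define m where "m = min (p + q) r"
  obtain \<kappa> where \<kappa>: "\<kappa> > 0" and choice: "\<And>\<epsilon> T. 0 < \<epsilon> \<Longrightarrow> \<epsilon> \<le> 1 \<Longrightarrow> 2 * C * \<epsilon> \<le> 1 \<Longrightarrow> T \<ge> 1 \<Longrightarrow>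
     T * \<epsilon> powr (m - 1) \<le> \<kappa> \<Longrightarrow> T powr (r + 1) * \<epsilon> powr (m * (r - 1)) \<le> \<kappa> \<Longrightarrow>
     (\<exists>a b M N.
       a = A * (2 * (C * \<epsilon>)) powr p * (2 * (C * \<epsilon>)) powr q + B * (2 * (C * \<epsilon>)) powr r \<and>
       b = A * N powr p * M powr q + B * M powr r \<and>
       3 * (R + 1) * a * T + b * T\<^sup>2 \<le> M \<and> (R + 1) * a + T * b \<le> N \<and> a * T \<le> M \<and> M \<le> C * \<epsilon> \<and> N \<le> 1)"
    using bootstrap_constants[OF pqr AB R1 Cpos] unfolding m_def by blast
  obtain e c where e: "e > 0" and c: "c > 0" and lifespan: "\<And>\<epsilon> T. 0 < \<epsilon> \<Longrightarrow> \<epsilon> \<le> e \<Longrightarrow> T > 0 \<Longrightarrow>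
       (p + q \<le> (r + 1) / 2 \<longrightarrow> T \<le> c * \<epsilon> powr (- (p + q - 1))) \<and>
       ((r + 1) / 2 \<le> p + q \<and> p + q \<le> r \<longrightarrow> T \<le> c * \<epsilon> powr (- ((p + q) * (r - 1) / (r + 1)))) \<and>
       (p + q \<ge> r \<longrightarrow> T \<le> c * \<epsilon> powr (- (r * (r - 1) / (r + 1)))) \<Longrightarrow>
       (T + 1) * \<epsilon> powr (m - 1) \<le> \<kappa> \<and> (T + 1) powr (r + 1) * \<epsilon> powr (m * (r - 1)) \<le> \<kappa>"
    using time_smallness[OF pqr \<kappa>] unfolding m_def by blast
  have solution: "\<exists>u. classical_solution A B p q r (\<lambda>x. \<epsilon> * f x) (\<lambda>x. \<epsilon> * g x) T u"
    if \<epsilon>: "0 < \<epsilon>" "\<epsilon> \<le> 1" "2 * C * \<epsilon> \<le> 1" and T: "T > 0"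
      and s: "(T + 1) * \<epsilon> powr (m - 1) \<le> \<kappa>" "(T + 1) powr (r + 1) * \<epsilon> powr (m * (r - 1)) \<le> \<kappa>" for \<epsilon> T
  proof -
    \<comment> \<open>The estimates are monotone in time; made for \<open>T + 1\<close>, they also serve short times.\<close>
    have "T + 1 \<ge> 1" using T by simp
    from choice[OF \<epsilon> this s] obtain a b M N where
      a: "a = A * (2 * (C * \<epsilon>)) powr p * (2 * (C * \<epsilon>)) powr q + B * (2 * (C * \<epsilon>)) powr r"
      and b: "b = A * N powr p * M powr q + B * M powr r"
      and i: "3 * (R + 1) * a * (T + 1) + b * (T + 1)\<^sup>2 \<le> M" "(R + 1) * a + (T + 1) * b \<le> N"
         "a * (T + 1) \<le> M" "M \<le> C * \<epsilon>" "N \<le> 1" by blast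
    have a0: "a \<ge> 0" and b0: "b \<ge> 0" using AB by (simp_all add: a b)
    have half: "\<bar>\<epsilon> * (x + y) / 2\<bar> \<le> C * \<epsilon> / 2" "\<bar>\<epsilon> * (x - y) / 2\<bar> \<le> C * \<epsilon> / 2"
      if "\<bar>x\<bar> + \<bar>y\<bar> \<le> C" for x y
    proof -
      have "\<epsilon> * \<bar>x + y\<bar> \<le> \<epsilon> * C" "\<epsilon> * \<bar>x - y\<bar> \<le> \<epsilon> * C"
        using \<epsilon> that by (intro mult_left_mono; linarith)+
      then show "\<bar>\<epsilon> * (x + y) / 2\<bar> \<le> C * \<epsilon> / 2" "\<bar>\<epsilon> * (x - y) / 2\<bar> \<le> C * \<epsilon> / 2"
        using \<epsilon> by (simp_all add: abs_mult mult.commute)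
    qed
    have CC: "\<bar>f y\<bar> + \<bar>P y\<bar> \<le> C" "\<bar>f1 y\<bar> + \<bar>g y\<bar> \<le> C" for y
      using C(1-4)[of y] C0 by (simp_all add: C_def)
    have bdd: "bounded (range (\<lambda>y. \<epsilon> * (f2 y + g1 y) / 2))" "bounded (range (\<lambda>y. \<epsilon> * (f2 y - g1 y) / 2))"
    proof -
      have b: "bounded (range f2)" "bounded (range g1)" using C(5,6) by (auto simp: bounded_iff)
      have h: "(\<lambda>y. \<epsilon> * k y / 2) = (\<lambda>y. (\<epsilon> / 2) *\<^sub>R k y)" for k :: "real \<Rightarrow> real" by auto
      show "bounded (range (\<lambda>y. \<epsilon> * (f2 y + g1 y) / 2))" "bounded (range (\<lambda>y. \<epsilon> * (f2 y - g1 y) / 2))"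
        unfolding h by (intro bounded_scaleR_comp bounded_plus_comp bounded_minus_comp b)+
    qed
    \<comment> \<open>The radius \<open>R + 1\<close> exceeds \<open>R\<close> so that on and beyond it the data vanish with their derivatives.\<close>
    interpret semilinear_wave
      "\<lambda>u v. A * \<bar>v\<bar> powr p * \<bar>u\<bar> powr q + B * \<bar>u\<bar> powr r"
      "\<lambda>u v. A * \<bar>v\<bar> powr p * (q * (\<bar>u\<bar> powr (q - 1) * sgn u)) + B * (r * (\<bar>u\<bar> powr (r - 1) * sgn u))"
      "\<lambda>u v. A * (p * (\<bar>v\<bar> powr (p - 1) * sgn v)) * \<bar>u\<bar> powr q"
      "\<lambda>y. \<epsilon> * (f y + P y) / 2" "\<lambda>y. \<epsilon> * (f1 y + g y) / 2" "\<lambda>y. \<epsilon> * (f2 y + g1 y) / 2"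
      "\<lambda>y. \<epsilon> * (f y - P y) / 2" "\<lambda>y. \<epsilon> * (f1 y - g y) / 2" "\<lambda>y. \<epsilon> * (f2 y - g1 y) / 2"
      T "R + 1" a b "C * \<epsilon>" M N
    proof (unfold_locales, goal_cases)
      case (1 u v u' v' x)
      then show ?case by (rule power_nonlinearity_chain[OF pqr])
    next
      case 2 show ?case by (rule power_nonlinearity_continuous[OF pqr])
    next
      case 3 show ?case by (rule power_nonlinearity_continuous[OF pqr])
    next
      case 4 show ?case by (rule power_nonlinearity_continuous[OF pqr])
    next
      case 5 show ?case using pqr by simp
    next
      case (6 y) show ?case by (rule derivative_eq_intros f P | simp)+
    next
      case (7 y) show ?case by (rule derivative_eq_intros f g | simp)+
    next
      case 8 show ?case by (intro continuous_intros f g) simp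
    next
      case 9 show ?case by (rule bdd)
    next
      case (10 y) show ?case by (rule derivative_eq_intros f P | simp)+
    next
      case (11 y) show ?case by (rule derivative_eq_intros f g | simp)+
    next
      case 12 show ?case by (intro continuous_intros f g) simp
    next
      case 13 show ?case by (rule bdd)
    next
      case (14 y)
      then have "R < \<bar>y\<bar>" by simp
      then show ?case by (simp add: fz gz f1z Pz)
    next
      case (15 y)
      show ?case by (intro conjI half CC)
    next
      case 16 show ?case by (rule T)
    next
      case 17 show ?case using R0 by simp
    next
      case 18 show ?case by (rule a0)
    next
      case 19 show ?case by (rule b0)
    next
      case 20
      have "3 * (R + 1) * a * T + b * T\<^sup>2 \<le> 3 * (R + 1) * a * (T + 1) + b * (T + 1)\<^sup>2"
        using a0 b0 R0 T by (intro add_mono mult_left_mono power_mono) auto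
      then show ?case using i(1) by simp
    next
      case 21
      have "T * b \<le> (T + 1) * b" using b0 by (intro mult_right_mono) auto
      then show ?case using i(2) by simp
    next
      case 22
      have "a * T \<le> a * (T + 1)" using a0 by (intro mult_left_mono) auto
      then show ?case using i(3,4) by simp
    next
      case 23 show ?case by (rule i(4))
    next
      case 24 show ?case using \<epsilon>(3) by simp
    next
      case 25 show ?case by (rule i(5))
    next
      case (26 u v)
      then show ?case unfolding a by (rule power_nonlinearity_mono[OF pqr AB])
    next
      case (27 u v)
      then show ?case unfolding b by (rule power_nonlinearity_mono[OF pqr AB])
    qed
    have "\<epsilon> * (f x + P x) / 2 + \<epsilon> * (f x - P x) / 2 = \<epsilon> * f x"
      "\<epsilon> * (f1 x + g x) / 2 - \<epsilon> * (f1 x - g x) / 2 = \<epsilon> * g x" for x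
      by (simp_all add: field_simps)
    then show ?thesis
      using classical_solution_exists unfolding classical_solution_def by simp
  qed
  define \<epsilon>2 where "\<epsilon>2 = min e (min 1 (1 / (2 * C)))"
  have \<epsilon>2: "\<epsilon>2 > 0" using e Cpos by (simp add: \<epsilon>2_def)
  have small: "\<epsilon> \<le> e" "\<epsilon> \<le> 1" "2 * C * \<epsilon> \<le> 1" if "\<epsilon> \<le> \<epsilon>2" for \<epsilon>
    using that Cpos by (auto simp: \<epsilon>2_def field_simps)
  show ?thesis
  proof (rule exI[of _ \<epsilon>2], rule conjI[OF \<epsilon>2], rule exI[of _ c], rule conjI[OF c], intro allI impI, elim conjE)
    fix \<epsilon> T :: real
    assume h: "0 < \<epsilon>" "\<epsilon> \<le> \<epsilon>2" "0 < T"
      "p + q \<le> (r + 1) / 2 \<longrightarrow> T \<le> c * \<epsilon> powr (- (p + q - 1))"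
      "(r + 1) / 2 \<le> p + q \<and> p + q \<le> r \<longrightarrow> T \<le> c * \<epsilon> powr (- ((p + q) * (r - 1) / (r + 1)))"
      "p + q \<ge> r \<longrightarrow> T \<le> c * \<epsilon> powr (- (r * (r - 1) / (r + 1)))"
    have "(T + 1) * \<epsilon> powr (m - 1) \<le> \<kappa> \<and> (T + 1) powr (r + 1) * \<epsilon> powr (m * (r - 1)) \<le> \<kappa>"
      by (rule lifespan) (use h small(1)[OF h(2)] in blast)+
    then show "\<exists>u. classical_solution A B p q r (\<lambda>x. \<epsilon> * f x) (\<lambda>x. \<epsilon> * g x) T u"
      using solution[OF h(1) small(2,3)[OF h(2)] h(3)] by blast
  qed
qed

end
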